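(* Let $0<\alpha\le1$, $x_0\in H$, $u\in L^2([0,b],U)$, $v_1,\dots,v_n\in U$. The mild solution of $$ \begin{cases} {}^{C}D^{\alpha}_{t_k^+}x(t)=Ax(t)+Bu(t), & t\in[0,b]\setminus\{t_1,\dots,t_n\},\\ \Delta x(t_k)=D_kx(t_k)+E_kv_k, & k=1,\dots,n,\\ x(0)=x_0 \end{cases} $$ is given by $$ \begin{cases} x(t)=\mathcal S_\alpha(t)x(0)+\int_0^t(t-s)^{\alpha-1}\mathcal P_\alpha(t-s)Bu(s)\,ds, & 0\le t\le t_1,\\ x(t)=\mathcal S_\alpha(t-t_k)x(t_k^+)+\int_{t_k}^t(t-s)^{\alpha-1}\mathcal P_\alpha(t-s)Bu(s)\,ds, & t_k<t\le t_{k+1},\ k=1,\dots,n, \end{cases} $$ where, for $k=1,\dots,n$, $$ \begin{aligned} x(t_k^+)=&\prod_{j=k}^{1}(\mathcal I+D_j)\mathcal S_\alpha(t_j-t_{j-1})\,x_0\\ &+\sum_{i=1}^k\Big[\prod_{j=k}^{i+1}(\mathcal I+D_j)\mathcal S_\alpha(t_j-t_{j-1})\Big](\mathcal I+D_i)\int_{t_{i-1}}^{t_i}(t_i-s)^{\alpha-1}\mathcal P_\alpha(t_i-s)Bu(s)\,ds\\ &+\sum_{i=2}^k\Big[\prod_{j=k}^{i}(\mathcal I+D_j)\mathcal S_\alpha(t_j-t_{j-1})\Big]E_{i-1}v_{i-1}+E_kv_k . \end{aligned} $$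
   Context: $H,U$ are real Hilbert spaces, $\mathcal I$ is the identity on $H$, $n\ge1$, $0=t_0<t_1<\dots<t_n<t_{n+1}=b$. $A:D(A)\subset H\to H$ generates a $C_0$-semigroup $\{S(t)\}_{t\ge0}$ on $H$; $B\in\mathcal L(U,H)$, $D_k\in\mathcal L(H)$, $E_k\in\mathcal L(U,H)$. ${}^CD^\alpha_{t_k^+}$ is the Caputo derivative of order $\alpha$ with lower limit $t_k$, used on $(t_k,t_{k+1}]$; $\Delta x(t_k)=x(t_k^+)-x(t_k^-)$ with the convention $x(t_k^-)=x(t_k)$. For $0<\alpha<1$ the Wright function is $\Psi_\alpha(\theta)=\sum_{m=0}^\infty\frac{(-\theta)^m}{m!\,\Gamma(-\alpha m+1-\alpha)}$, and for $t\ge0$ $$\mathcal S_\alpha(t)=\int_0^\infty\Psi_\alpha(\theta)S(t^\alpha\theta)\,d\theta,\qquad \mathcal P_\alpha(t)=\int_0^\infty\alpha\theta\Psi_\alpha(\theta)S(t^\alpha\theta)\,d\theta .$$ For $\alpha=1$, $\mathcal S_1(t)=\mathcal P_1(t)=S(t)$. Products with decreasing index are ordered: $\prod_{j=k}^{i}T_j=T_kT_{k-1}\cdots T_i$ for $k\ge i$; empty products are $\mathcal I$ and empty sums are $0$. Mild solution: for an initial time $\tau$ and initial value $y$, the mild solution of ${}^CD^\alpha_{\tau^+}x(t)=Ax(t)+Bu(t)$, $x(\tau)=y$, is the function given by the fractional variation of parameters formula $x(t)=\mathcal S_\alpha(t-\tau)y+\int_\tau^t(t-s)^{\alpha-1}\mathcal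 P_\alpha(t-s)Bu(s)\,ds$. A mild solution of the impulsive system is a function $x$ on $[0,b]$ for which these integrals exist, which is the mild solution with $\tau=0$, $y=x_0$ on $[0,t_1]$, and on each $(t_k,t_{k+1}]$, $k=1,\dots,n$, is the mild solution with $\tau=t_k$ and $y=x(t_k^+)$, where the post-impulse state is $x(t_k^+)=x(t_k)+\Delta x(t_k)=(\mathcal I+D_k)x(t_k)+E_kv_k$. *)

theory Defs
  imports "HOL-Analysis.Analysis"
begin

(* The library's Bochner integral is restricted to second-countable target spaces, whereas the
   Hilbert spaces here need not be separable.  The definitions below follow has_bochner_integral
   and lebesgue_integral, with Borel measurability replaced by strong measurability, that is,
   being an a.e. limit of simple functions.  They are only used for complete measures. *)

definition strongly_measurable :: "'a measure \<Rightarrow> ('a \<Rightarrow> 'b::topological_space) \<Rightarrow> bool" where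
  "strongly_measurable M f \<longleftrightarrow>
    (\<exists>s. (\<forall>i::nat. simple_function M (s i)) \<and> (AE x in M. (\<lambda>i. s i x) \<longlonglongrightarrow> f x))"

definition has_Bochner_int :: "'a measure \<Rightarrow> ('a \<Rightarrow> 'b::real_normed_vector) \<Rightarrow> 'b \<Rightarrow> bool" where
  "has_Bochner_int M f y \<longleftrightarrow> strongly_measurable M f \<and>
    (\<exists>s. (\<forall>i::nat. Bochner_Integration.simple_bochner_integrable M (s i)) \<and>
      (\<lambda>i. \<integral>\<^sup>+x. norm (f x - s i x) \<partial>M) \<longlonglongrightarrow> 0 \<and>
      (\<lambda>i. Bochner_Integration.simple_bochner_integral M (s i)) \<longlonglongrightarrow> y)"

definition Bochner_integrable :: "'a measure \<Rightarrow> ('a \<Rightarrow> 'b::real_normed_vector) \<Rightarrow> bool" where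
  "Bochner_integrable M f \<longleftrightarrow> (\<exists>y. has_Bochner_int M f y)"

definition Bochner_int :: "'a measure \<Rightarrow> ('a \<Rightarrow> 'b::real_normed_vector) \<Rightarrow> 'b" where
  "Bochner_int M f = (if Bochner_integrable M f then (THE y. has_Bochner_int M f y) else 0)"

definition L2_on :: "real set \<Rightarrow> (real \<Rightarrow> 'b::real_normed_vector) \<Rightarrow> bool" where
  "L2_on X u \<longleftrightarrow> strongly_measurable (lebesgue_on X) u \<and>
    integrable (lebesgue_on X) (\<lambda>s. (norm (u s))\<^sup>2)"

(* Only the values S t with t \<ge> 0 are relevant. *)
definition C0_semigroup :: "(real \<Rightarrow> 'h::real_normed_vector \<Rightarrow>\<^sub>L 'h) \<Rightarrow> bool" where
  "C0_semigroup S \<longleftrightarrow> S 0 = id_blinfun \<and>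
    (\<forall>s\<ge>0. \<forall>t\<ge>0. S (s + t) = S s o\<^sub>L S t) \<and>
    (\<forall>y. ((\<lambda>t. S t y) \<longlongrightarrow> y) (at_right 0))"

(* The unbounded operator A is given by its domain dom_A and its values on dom_A. *)
definition generates_C0_semigroup ::
  "'h set \<Rightarrow> ('h \<Rightarrow> 'h) \<Rightarrow> (real \<Rightarrow> 'h::real_normed_vector \<Rightarrow>\<^sub>L 'h) \<Rightarrow> bool" where
  "generates_C0_semigroup dom_A A S \<longleftrightarrow> C0_semigroup S \<and>
    dom_A = {y. \<exists>z. ((\<lambda>t. (S t y - y) /\<^sub>R t) \<longlongrightarrow> z) (at_right 0)} \<and>
    (\<forall>y\<in>dom_A. ((\<lambda>t. (S t y - y) /\<^sub>R t) \<longlongrightarrow> A y) (at_right 0))"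

(* rGamma is the entire function 1/Gamma, so that terms at poles of Gamma vanish. *)
definition wright :: "real \<Rightarrow> real \<Rightarrow> real" where
  "wright \<alpha> \<theta> = (\<Sum>m. (- \<theta>) ^ m / fact m * rGamma (- \<alpha> * real m + 1 - \<alpha>))"

(* The operator-valued integrals are taken in the strong sense, i.e. pointwise in H. *)
definition S_op ::
  "real \<Rightarrow> (real \<Rightarrow> 'h::real_normed_vector \<Rightarrow>\<^sub>L 'h) \<Rightarrow> real \<Rightarrow> 'h \<Rightarrow> 'h" where
  "S_op \<alpha> S t y = (if \<alpha> = 1 then S t y else
    Bochner_int (lebesgue_on {0..}) (\<lambda>\<theta>. wright \<alpha> \<theta> *\<^sub>R S (t powr \<alpha> * \<theta>) y))"

definition P_op ::
  "real \<Rightarrow> (real \<Rightarrow> 'h::real_normed_vector \<Rightarrow>\<^sub>L 'h) \<Rightarrow> real \<Rightarrow> 'h \<Rightarrow> 'h" where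
  "P_op \<alpha> S t y = (if \<alpha> = 1 then S t y else
    Bochner_int (lebesgue_on {0..}) (\<lambda>\<theta>. (\<alpha> * \<theta> * wright \<alpha> \<theta>) *\<^sub>R S (t powr \<alpha> * \<theta>) y))"

definition conv_integrand ::
  "real \<Rightarrow> (real \<Rightarrow> 'h::real_normed_vector \<Rightarrow>\<^sub>L 'h) \<Rightarrow> ('u::real_normed_vector \<Rightarrow>\<^sub>L 'h) \<Rightarrow>
   (real \<Rightarrow> 'u) \<Rightarrow> real \<Rightarrow> real \<Rightarrow> 'h" where
  "conv_integrand \<alpha> S B u t s = (t - s) powr (\<alpha> - 1) *\<^sub>R P_op \<alpha> S (t - s) (B (u s))"

definition conv_exists ::
  "real \<Rightarrow> (real \<Rightarrow> 'h::real_normed_vector \<Rightarrow>\<^sub>L 'h) \<Rightarrow> ('u::real_normed_vector \<Rightarrow>\<^sub>L 'h) \<Rightarrow>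
   (real \<Rightarrow> 'u) \<Rightarrow> real \<Rightarrow> real \<Rightarrow> bool" where
  "conv_exists \<alpha> S B u \<tau> t \<longleftrightarrow>
    Bochner_integrable (lebesgue_on {\<tau>..t}) (conv_integrand \<alpha> S B u t)"

definition conv ::
  "real \<Rightarrow> (real \<Rightarrow> 'h::real_normed_vector \<Rightarrow>\<^sub>L 'h) \<Rightarrow> ('u::real_normed_vector \<Rightarrow>\<^sub>L 'h) \<Rightarrow>
   (real \<Rightarrow> 'u) \<Rightarrow> real \<Rightarrow> real \<Rightarrow> 'h" where
  "conv \<alpha> S B u \<tau> t = Bochner_int (lebesgue_on {\<tau>..t}) (conv_integrand \<alpha> S B u t)"

(* x agrees on J with the mild solution with initial time \<tau> and initial value y. *)
definition mild_solution_on ::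
  "real \<Rightarrow> (real \<Rightarrow> 'h::real_normed_vector \<Rightarrow>\<^sub>L 'h) \<Rightarrow> ('u::real_normed_vector \<Rightarrow>\<^sub>L 'h) \<Rightarrow>
   (real \<Rightarrow> 'u) \<Rightarrow> real \<Rightarrow> 'h \<Rightarrow> real set \<Rightarrow> (real \<Rightarrow> 'h) \<Rightarrow> bool" where
  "mild_solution_on \<alpha> S B u \<tau> y J x \<longleftrightarrow>
    (\<forall>t\<in>J. conv_exists \<alpha> S B u \<tau> t \<and> x t = S_op \<alpha> S (t - \<tau>) y + conv \<alpha> S B u \<tau> t)"

(* The post-impulse state x(t_k+) = x(t_k) + Delta x(t_k), with the convention x(t_k-) = x(t_k). *)
definition post_impulse ::
  "(nat \<Rightarrow> 'h::real_normed_vector \<Rightarrow>\<^sub>L 'h) \<Rightarrow> (nat \<Rightarrow> 'u::real_normed_vector \<Rightarrow>\<^sub>L 'h) \<Rightarrow>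
   (nat \<Rightarrow> 'u) \<Rightarrow> (nat \<Rightarrow> real) \<Rightarrow> (real \<Rightarrow> 'h) \<Rightarrow> nat \<Rightarrow> 'h" where
  "post_impulse D E v T x k = (id_blinfun + D k) (x (T k)) + E k (v k)"

definition impulsive_mild_solution ::
  "real \<Rightarrow> (real \<Rightarrow> 'h::real_normed_vector \<Rightarrow>\<^sub>L 'h) \<Rightarrow> ('u::real_normed_vector \<Rightarrow>\<^sub>L 'h) \<Rightarrow>
   (nat \<Rightarrow> 'h \<Rightarrow>\<^sub>L 'h) \<Rightarrow> (nat \<Rightarrow> 'u \<Rightarrow>\<^sub>L 'h) \<Rightarrow> nat \<Rightarrow> (nat \<Rightarrow> real) \<Rightarrow>
   'h \<Rightarrow> (real \<Rightarrow> 'u) \<Rightarrow> (nat \<Rightarrow> 'u) \<Rightarrow> (real \<Rightarrow> 'h) \<Rightarrow> bool" where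
  "impulsive_mild_solution \<alpha> S B D E n T x0 u v x \<longleftrightarrow>
    mild_solution_on \<alpha> S B u 0 x0 {0..T 1} x \<and>
    (\<forall>k\<in>{1..n}.
      mild_solution_on \<alpha> S B u (T k) (post_impulse D E v T x k) {T k<..T (Suc k)} x)"

(* desc_prod F k i = F k \<circ> F (k - 1) \<circ> \<dots> \<circ> F i, the identity if i > k. *)
definition desc_prod :: "(nat \<Rightarrow> 'h \<Rightarrow> 'h) \<Rightarrow> nat \<Rightarrow> nat \<Rightarrow> 'h \<Rightarrow> 'h" where
  "desc_prod F k i = fold F [i..<Suc k]"

end

(* The formula for x(t_k+) is the closed form of an affine recursion, which follows from the
   additivity of S_op; the condition x 0 = x0 needs S_op at time 0 to be the identity. For alpha < 1
   both rest on the decay of the Wright function beyond every exponential and on its integral over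
   [0, oo) being 1. These come from Hankel's integral for 1/Gamma: summing the series under the
   integral gives the Wright function as the imaginary part of the integral of
   exp (s - theta * s^alpha) * s^(alpha - 1) over a ray s = R + r * cis phi with pi/2 < phi and
   alpha * phi < pi/2, and on this ray Re (s^alpha) is bounded below by a multiple of R^alpha. *)

theory Submission
  imports
    Defs
    "HOL-Complex_Analysis.Complex_Analysis"
    "HOL-Real_Asymp.Real_Asymp"
begin

section \<open>Bochner integrals of right-continuous functions\<close>

text \<open>H may be non-separable, so linearity of the integral in \<open>S_op\<close> is obtained
  along explicit approximants that depend linearly on the integrand; limits from the right, which
  the semigroup law yields for every orbit, are enough for them. An orbit may grow like exp
  (\<omega> t) with no control on \<omega>, so decay of the Wright function at one fixed rate would
  not make the integral converge for all t. In the series, 1/Gamma is sampled only at points \<mu> -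
  \<alpha> m \<le> 1. For z < 0 the power s^(-z) is continuous at 0 and the contour can be collapsed
  onto the negative axis; the points of [0, 1] are reached from there. The parameter \<mu> is
  carried along because the total integral is read off from the case \<mu> = 1, whose derivative is
  minus the case \<mu> = 1 - \<alpha> of the theorem.\<close>

lemma borel_measurable_norm_diff_simple:
  fixes f :: "'a \<Rightarrow> 'b::real_normed_vector"
  assumes "\<And>i. simple_function M (s i)" and "\<And>x. x \<in> space M \<Longrightarrow> (\<lambda>i. s i x) \<longlonglongrightarrow> f x"
    and "simple_function M t"
  shows "(\<lambda>x. norm (f x - t x)) \<in> borel_measurable M"
proof (rule borel_measurable_LIMSEQ_real)
  show "(\<lambda>i. norm (s i x - t x)) \<longlonglongrightarrow> norm (f x - t x)" if "x \<in> space M" for x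
    using assms(2)[OF that] by (intro tendsto_intros)
  \<comment> \<open>Differences are formed between simple functions only, whose ranges are finite,
    so measurability of subtraction on the target space does not enter.\<close>
  show "(\<lambda>x. norm (s i x - t x)) \<in> borel_measurable M" for i
    by (intro borel_measurable_simple_function
        simple_function_compose2[where h="\<lambda>a b. norm (a - b)"] assms)
qed

text \<open>Two approximants are compared through \<open>f\<close>. The same estimate gives the
  uniqueness of the integral and the Cauchy property of approximating integrals.\<close>

lemma norm_simple_bochner_integral_diff_le:
  fixes f :: "'a \<Rightarrow> 'b::real_normed_vector"
  assumes s: "Bochner_Integration.simple_bochner_integrable M s"
    and t: "Bochner_Integration.simple_bochner_integrable M t"
    and [measurable]: "(\<lambda>x. norm (f x - s x)) \<in> borel_measurable M"
      "(\<lambda>x. norm (f x - t x)) \<in> borel_measurable M"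
  shows "ennreal (norm (Bochner_Integration.simple_bochner_integral M s
      - Bochner_Integration.simple_bochner_integral M t))
    \<le> (\<integral>\<^sup>+x. norm (f x - s x) \<partial>M) + (\<integral>\<^sup>+x. norm (f x - t x) \<partial>M)"
proof -
  let ?I = "Bochner_Integration.simple_bochner_integral M"
  have "ennreal (norm (?I s - ?I t)) = norm (?I (\<lambda>x. s x - t x))"
    using s t by (subst simple_bochner_integral_diff) auto
  also have "\<dots> \<le> ?I (\<lambda>x. norm (s x - t x))"
    using simple_bochner_integrable_compose2[of "(-)" M "s" "t"] s t
    by (auto intro!: simple_bochner_integral_norm_bound)
  also have "\<dots> = (\<integral>\<^sup>+x. norm (s x - t x) \<partial>M)"
    using simple_bochner_integrable_compose2[of "\<lambda>x y. norm (x - y)" M "s" "t"] s t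
    by (auto intro!: simple_bochner_integral_eq_nn_integral)
  also have "\<dots> \<le> (\<integral>\<^sup>+x. ennreal (norm (f x - s x)) + ennreal (norm (f x - t x)) \<partial>M)"
  proof (intro nn_integral_mono)
    fix x
    have "norm (s x - t x) \<le> norm (f x - s x) + norm (f x - t x)"
      by (metis dual_order.refl norm_diff_triangle_le norm_minus_commute)
    then show "ennreal (norm (s x - t x)) \<le> ennreal (norm (f x - s x)) + ennreal (norm (f x - t x))"
      by (metis ennreal_leI ennreal_plus norm_ge_zero)
  qed
  also have "\<dots> = (\<integral>\<^sup>+x. norm (f x - s x) \<partial>M) + (\<integral>\<^sup>+x. norm (f x - t x) \<partial>M)"
    by (rule nn_integral_add) auto
  finally show ?thesis .
qed

text \<open>The sequence \<open>r\<close> makes \<open>norm (f x - s x)\<close> measurable for every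
  simple \<open>s\<close>, as the preceding estimate demands; the value is then pinned down by the
  triangle inequality.\<close>

lemma has_Bochner_int_unique:
  fixes f :: "'a \<Rightarrow> 'b::real_normed_vector"
  assumes r: "\<And>i. simple_function M (r i)" "\<And>x. x \<in> space M \<Longrightarrow> (\<lambda>i. r i x) \<longlonglongrightarrow> f x"
    and "has_Bochner_int M f y" "has_Bochner_int M f z"
  shows "y = z"
proof -
  let ?I = "Bochner_Integration.simple_bochner_integral M"
  obtain s where s: "\<And>i. Bochner_Integration.simple_bochner_integrable M (s i)"
    "(\<lambda>i. \<integral>\<^sup>+x. norm (f x - s i x) \<partial>M) \<longlonglongrightarrow> 0" "(\<lambda>i. ?I (s i)) \<longlonglongrightarrow> y"
    using assms(3) unfolding has_Bochner_int_def by auto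
  obtain t where t: "\<And>i. Bochner_Integration.simple_bochner_integrable M (t i)"
    "(\<lambda>i. \<integral>\<^sup>+x. norm (f x - t i x) \<partial>M) \<longlonglongrightarrow> 0" "(\<lambda>i. ?I (t i)) \<longlonglongrightarrow> z"
    using assms(4) unfolding has_Bochner_int_def by auto
  have m: "(\<lambda>x. norm (f x - s i x)) \<in> borel_measurable M"
    "(\<lambda>x. norm (f x - t i x)) \<in> borel_measurable M" for i
    using s(1)[of i] t(1)[of i]
    by (auto intro!: borel_measurable_norm_diff_simple[OF r]
        elim: Bochner_Integration.simple_bochner_integrable.cases)
  have "(\<lambda>i. ennreal (norm (?I (s i) - ?I (t i)))) \<longlonglongrightarrow> ennreal (norm (y - z))"
    using s(3) t(3) by (intro tendsto_intros)
  moreover have "(\<lambda>i. ennreal (norm (?I (s i) - ?I (t i)))) \<longlonglongrightarrow> 0"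
  proof (rule tendsto_sandwich[OF _ _ tendsto_const])
    show "\<forall>\<^sub>F i in sequentially. ennreal (norm (?I (s i) - ?I (t i)))
        \<le> (\<integral>\<^sup>+x. norm (f x - s i x) \<partial>M) + (\<integral>\<^sup>+x. norm (f x - t i x) \<partial>M)"
      using norm_simple_bochner_integral_diff_le[OF s(1) t(1) m] by simp
    show "(\<lambda>i. (\<integral>\<^sup>+x. norm (f x - s i x) \<partial>M) + (\<integral>\<^sup>+x. norm (f x - t i x) \<partial>M)) \<longlonglongrightarrow> 0"
      using tendsto_add[OF s(2) t(2)] by simp
  qed auto
  ultimately have "ennreal (norm (y - z)) = 0"
    using LIMSEQ_unique by blast
  then show ?thesis by simp
qed

lemma Bochner_int_eq:
  fixes f :: "'a \<Rightarrow> 'b::real_normed_vector"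
  assumes "\<And>i. simple_function M (r i)" "\<And>x. x \<in> space M \<Longrightarrow> (\<lambda>i. r i x) \<longlonglongrightarrow> f x"
    and "has_Bochner_int M f y"
  shows "Bochner_int M f = y"
  using assms has_Bochner_int_unique[OF assms(1,2)]
  unfolding Bochner_int_def Bochner_integrable_def by auto

text \<open>Dominated convergence makes the L1 distances to \<open>f\<close> vanish, so the
  integrals are Cauchy and completeness of the target supplies the limit. The given sequence
  \<open>s\<close> is kept in the conclusion so that linearity can later be proved along it.\<close>

lemma has_Bochner_int_dominated:
  fixes f :: "'a \<Rightarrow> 'b::banach"
  assumes s: "\<And>i. simple_function M (s i)" "\<And>x. x \<in> space M \<Longrightarrow> (\<lambda>i. s i x) \<longlonglongrightarrow> f x"
    and g: "integrable M g" "\<And>i x. x \<in> space M \<Longrightarrow> norm (s i x) \<le> g x"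
  shows "Bochner_Integration.simple_bochner_integrable M (s i)"
    and "(\<lambda>i. Bochner_Integration.simple_bochner_integral M (s i)) \<longlonglongrightarrow> Bochner_int M f"
    and "has_Bochner_int M f (Bochner_int M f)"
proof -
  let ?I = "Bochner_Integration.simple_bochner_integral M"
  have g0: "g x \<ge> 0" if "x \<in> space M" for x
    using g(2)[OF that, of 0] norm_ge_zero order_trans by blast
  have fin: "(\<integral>\<^sup>+x. norm (s i x) \<partial>M) < \<infinity>" for i
  proof -
    have "(\<integral>\<^sup>+x. norm (s i x) \<partial>M) \<le> (\<integral>\<^sup>+x. norm (g x) \<partial>M)"
      using g(2) g0 by (intro nn_integral_mono) (auto intro!: ennreal_leI)
    then show ?thesis using g(1) by (auto simp: integrable_iff_bounded)
  qed
  show sb: "Bochner_Integration.simple_bochner_integrable M (s i)" for i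
    by (rule simple_bochner_integrableI_bounded[OF s(1) fin])
  note m = borel_measurable_norm_diff_simple[OF s s(1)]
  have fg: "norm (f x) \<le> g x" if "x \<in> space M" for x
    using s(2)[OF that] g(2)[OF that] by (intro LIMSEQ_le_const2[OF tendsto_norm]) auto
  have lim0: "(\<lambda>i. \<integral>\<^sup>+x. norm (f x - s i x) \<partial>M) \<longlonglongrightarrow> 0"
  proof -
    have "(\<lambda>i. \<integral>\<^sup>+x. ennreal (norm (f x - s i x)) \<partial>M) \<longlonglongrightarrow> (\<integral>\<^sup>+x. 0 \<partial>M)"
    proof (rule nn_integral_dominated_convergence[where w="\<lambda>x. ennreal (2 * g x)"])
      show "(\<integral>\<^sup>+x. ennreal (2 * g x) \<partial>M) < \<infinity>"
      proof -
        have "(\<integral>\<^sup>+x. ennreal (2 * g x) \<partial>M) = (\<integral>\<^sup>+x. norm (2 * g x) \<partial>M)"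
          using g0 by (intro nn_integral_cong) auto
        also have "\<dots> < \<infinity>"
          using integrable_mult_right[OF g(1), of 2] unfolding integrable_iff_bounded by blast
        finally show ?thesis .
      qed
      show "AE x in M. ennreal (norm (f x - s i x)) \<le> ennreal (2 * g x)" for i
      proof (intro AE_I2 ennreal_leI)
        fix x assume "x \<in> space M"
        then show "norm (f x - s i x) \<le> 2 * g x"
          using norm_triangle_ineq4[of "f x" "s i x"] fg g(2)[of x i] by fastforce
      qed
      show "AE x in M. (\<lambda>i. ennreal (norm (f x - s i x))) \<longlonglongrightarrow> 0"
      proof (intro AE_I2)
        fix x assume "x \<in> space M"
        then have "(\<lambda>i. ennreal (norm (f x - s i x))) \<longlonglongrightarrow> ennreal (norm (f x - f x))"
          by (intro tendsto_intros s(2))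
        then show "(\<lambda>i. ennreal (norm (f x - s i x))) \<longlonglongrightarrow> 0" by simp
      qed
    qed (use m g(1) in auto)
    then show ?thesis by simp
  qed
  have "Cauchy (\<lambda>i. ?I (s i))"
    unfolding Cauchy_def
  proof (intro allI impI)
    fix e :: real assume "e > 0"
    then have "\<forall>\<^sub>F i in sequentially. (\<integral>\<^sup>+x. norm (f x - s i x) \<partial>M) < ennreal (e / 2)"
      using lim0 by (intro order_tendstoD) (auto simp: ennreal_zero_less_divide)
    then obtain N where N: "\<And>i. i \<ge> N \<Longrightarrow> (\<integral>\<^sup>+x. norm (f x - s i x) \<partial>M) < ennreal (e / 2)"
      by (auto simp: eventually_sequentially)
    show "\<exists>N. \<forall>m\<ge>N. \<forall>n\<ge>N. dist (?I (s m)) (?I (s n)) < e"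
    proof (intro exI allI impI)
      fix m' n assume "N \<le> m'" "N \<le> n"
      have "ennreal (norm (?I (s m') - ?I (s n)))
          \<le> (\<integral>\<^sup>+x. norm (f x - s m' x) \<partial>M) + (\<integral>\<^sup>+x. norm (f x - s n x) \<partial>M)"
        by (rule norm_simple_bochner_integral_diff_le[OF sb sb m m])
      also have "\<dots> < ennreal (e / 2) + ennreal (e / 2)"
        by (intro add_strict_mono N \<open>N \<le> m'\<close> \<open>N \<le> n\<close>)
      also have "\<dots> = ennreal e" using \<open>e > 0\<close> by (simp flip: ennreal_plus)
      finally show "dist (?I (s m')) (?I (s n)) < e"
        using \<open>e > 0\<close> by (simp add: dist_norm ennreal_less_iff)
    qed
  qed
  then obtain y where y: "(\<lambda>i. ?I (s i)) \<longlonglongrightarrow> y"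
    using Cauchy_convergent convergent_def by blast
  have h: "has_Bochner_int M f y"
    unfolding has_Bochner_int_def strongly_measurable_def
    using s sb lim0 y by (auto intro!: exI[of _ s])
  then show "has_Bochner_int M f (Bochner_int M f)" "(\<lambda>i. ?I (s i)) \<longlonglongrightarrow> Bochner_int M f"
    using y Bochner_int_eq[OF s h] by auto
qed

text \<open>Every simple integral vanishes, so 0 is the only possible value, and 0 is also the
  default for a non-integrable \<open>f\<close>. Applied to the convolution over a one-point
  interval.\<close>

lemma Bochner_int_null_measure:
  fixes f :: "'a \<Rightarrow> 'b::real_normed_vector"
  assumes "emeasure M (space M) = 0"
  shows "Bochner_int M f = 0"
proof -
  let ?I = "Bochner_Integration.simple_bochner_integral M"
  have I0: "?I s = 0" for s :: "'a \<Rightarrow> 'b"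
  proof -
    have "emeasure M {x \<in> space M. s x = y} = 0" for y
      using emeasure_space[of M "{x \<in> space M. s x = y}"] assms by simp
    then show ?thesis
      unfolding Bochner_Integration.simple_bochner_integral_def by (simp add: measure_def)
  qed
  have "y = 0" if "has_Bochner_int M f y" for y
    using that unfolding has_Bochner_int_def I0 by (auto dest: LIMSEQ_unique[OF tendsto_const])
  then show ?thesis
    unfolding Bochner_int_def Bochner_integrable_def by (auto intro!: the_equality)
qed

section \<open>Step functions sampled to the right on a grid\<close>

definition right_continuous :: "(real \<Rightarrow> 'b::topological_space) \<Rightarrow> bool" where
  "right_continuous f \<longleftrightarrow> (\<forall>x\<ge>0. (f \<longlongrightarrow> f x) (at_right x))"

text \<open>The value \<open>- 1\<close> marks the complement of [0, i), so the range is finite and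
  every function of the index is simple. The mesh 1/(i + 1) and the truncation at i are refined
  together.\<close>

definition grid_index :: "nat \<Rightarrow> real \<Rightarrow> int" where
  "grid_index i x = (if 0 \<le> x \<and> x < real i then \<lfloor>real (Suc i) * x\<rfloor> else - 1)"

text \<open>The sample point is the right end of the grid cell and lies strictly beyond
  \<open>x\<close>: right limits therefore force convergence, and a decreasing bound at the sample
  point is a bound at \<open>x\<close>.\<close>

definition right_step :: "nat \<Rightarrow> (real \<Rightarrow> 'b::real_vector) \<Rightarrow> real \<Rightarrow> 'b" where
  "right_step i f x = (if grid_index i x < 0 then 0
     else f ((real_of_int (grid_index i x) + 1) / real (Suc i)))"

lemma simple_function_grid_index: "simple_function (lebesgue_on {0..}) (grid_index i)"
proof -
  define m where "m = \<lfloor>real (Suc i) * real i\<rfloor>"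
  have "grid_index i x \<in> {- 1} \<union> {0..m}" for x
  proof (cases "0 \<le> x \<and> x < real i")
    case True
    then have "real (Suc i) * x \<le> real (Suc i) * real i" by (intro mult_left_mono) auto
    then have "\<lfloor>real (Suc i) * x\<rfloor> \<le> m" unfolding m_def by (rule floor_mono)
    moreover have "0 \<le> \<lfloor>real (Suc i) * x\<rfloor>"
      unfolding zero_le_floor using True by (intro mult_nonneg_nonneg) auto
    ultimately show ?thesis
      unfolding grid_index_def if_P[OF True] by (metis UnI2 atLeastAtMost_iff)
  next
    case False
    show ?thesis unfolding grid_index_def if_not_P[OF False] by blast
  qed
  then have "grid_index i ` space (lebesgue_on {0..}) \<subseteq> {- 1} \<union> {0..m}" by blast
  then have "finite (grid_index i ` space (lebesgue_on {0..}))"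
    by (rule finite_subset) simp
  moreover have "grid_index i \<in> measurable (lebesgue_on {0..}) (count_space UNIV)"
  proof (rule measurable_restrict_space1)
    have "grid_index i \<in> measurable borel (count_space UNIV)"
      unfolding grid_index_def by measurable
    then show "grid_index i \<in> measurable lebesgue (count_space UNIV)"
      by (simp add: measurable_completion)
  qed
  ultimately show ?thesis
    unfolding simple_function_def by (intro conjI ballI measurable_sets[of "grid_index i"]) auto
qed

lemma simple_function_right_step: "simple_function (lebesgue_on {0..}) (right_step i f)"
  unfolding right_step_def
  by (rule simple_function_compose1[OF simple_function_grid_index,
      where g="\<lambda>k. if k < 0 then 0 else f ((real_of_int k + 1) / real (Suc i))"])

lemma right_step_eq:
  assumes "0 \<le> x" "x < real i"
  shows "right_step i f x = f ((real_of_int \<lfloor>real (Suc i) * x\<rfloor> + 1) / real (Suc i))"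
proof -
  have "grid_index i x = \<lfloor>real (Suc i) * x\<rfloor>"
    unfolding grid_index_def using assms by (intro if_P conjI)
  moreover have "\<not> \<lfloor>real (Suc i) * x\<rfloor> < 0"
    unfolding not_less zero_le_floor using assms(1) by (rule mult_nonneg_nonneg[OF of_nat_0_le_iff])
  ultimately show ?thesis unfolding right_step_def by (metis (mono_tags))
qed

lemma right_step_cases:
  assumes "0 \<le> x"
  obtains "right_step i f x = 0" | z where "x < z" "right_step i f x = f z"
proof (cases "x < real i")
  case True
  have "real (Suc i) * x < real_of_int \<lfloor>real (Suc i) * x\<rfloor> + 1" by linarith
  then have "x < (real_of_int \<lfloor>real (Suc i) * x\<rfloor> + 1) / real (Suc i)"
    by (auto simp: field_simps simp del: of_nat_Suc)
  then show ?thesis using right_step_eq[OF assms True] by (rule that(2))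
next
  case False
  then have "right_step i f x = 0" by (simp add: right_step_def grid_index_def)
  then show ?thesis by (rule that(1))
qed

lemma right_step_tendsto:
  assumes "right_continuous f" "0 \<le> x"
  shows "(\<lambda>i. right_step i f x) \<longlonglongrightarrow> f x"
proof -
  define z where "z i = (real_of_int \<lfloor>real (Suc i) * x\<rfloor> + 1) / real (Suc i)" for i
  have z: "x < z i" "z i \<le> x + 1 / real (Suc i)" for i
  proof -
    have "real (Suc i) * x < real_of_int \<lfloor>real (Suc i) * x\<rfloor> + 1"
      "real_of_int \<lfloor>real (Suc i) * x\<rfloor> \<le> real (Suc i) * x" by linarith+
    then show "x < z i" "z i \<le> x + 1 / real (Suc i)"
      unfolding z_def by (auto simp: field_simps simp del: of_nat_Suc)
  qed
  have "z \<longlonglongrightarrow> x"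
  proof (rule tendsto_sandwich[OF _ _ tendsto_const])
    show "(\<lambda>i. x + 1 / real (Suc i)) \<longlonglongrightarrow> x"
      using tendsto_add[OF tendsto_const[of x] LIMSEQ_Suc[OF lim_1_over_n]] by simp
    show "\<forall>\<^sub>F i in sequentially. x \<le> z i" "\<forall>\<^sub>F i in sequentially. z i \<le> x + 1 / real (Suc i)"
      using z by (auto intro!: always_eventually less_imp_le simp del: of_nat_Suc)
  qed
  then have "filterlim z (at_right x) sequentially"
    unfolding filterlim_at using z(1) by (auto intro!: always_eventually simp: less_le dest: sym)
  then have "(\<lambda>i. f (z i)) \<longlonglongrightarrow> f x"
    using assms filterlim_compose unfolding right_continuous_def by blast
  moreover have "\<forall>\<^sub>F i in sequentially. f (z i) = right_step i f x"
    using eventually_gt_at_top[of "nat \<lceil>x\<rceil>"]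
  proof eventually_elim
    case (elim i)
    then have "x < real i" by linarith
    then show ?case unfolding z_def using right_step_eq[OF assms(2)] by metis
  qed
  ultimately show ?thesis by (rule Lim_transform_eventually)
qed

lemma integrable_exp_neg:
  assumes "0 < c"
  shows "integrable (lebesgue_on {0..}) (\<lambda>x::real. exp (- c * x))"
proof -
  have "(\<lambda>x. exp (- c * x)) absolutely_integrable_on {0..}"
    by (rule nonnegative_absolutely_integrable_1)
      (use integrable_on_exp_minus_to_infinity[OF assms, of 0] in auto)
  then show ?thesis
    by (simp add: set_integrable_def integrable_restrict_space)
qed

lemma right_step_le:
  fixes f :: "real \<Rightarrow> 'b::real_normed_vector"
  assumes "\<And>x. 0 \<le> x \<Longrightarrow> norm (f x) \<le> C * exp (- c * x)" "0 \<le> c" "0 \<le> x"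
  shows "norm (right_step i f x) \<le> C * exp (- c * x)"
proof -
  have C: "0 \<le> C" using order_trans[OF norm_ge_zero assms(1)[of 0]] by simp
  consider "right_step i f x = 0" | z where "x < z" "right_step i f x = f z"
    using right_step_cases[OF assms(3)] by metis
  then show ?thesis
  proof cases
    case 2
    have "norm (f z) \<le> C * exp (- c * z)" using 2 assms by simp
    also have "\<dots> \<le> C * exp (- c * x)"
      using 2 C assms by (intro mult_left_mono) (auto intro: mult_left_mono)
    finally show ?thesis using 2 by simp
  qed (use C in simp)
qed

lemma right_continuous_has_Bochner_int:
  fixes f :: "real \<Rightarrow> 'b::banach"
  assumes "right_continuous f" "\<And>x. 0 \<le> x \<Longrightarrow> norm (f x) \<le> C * exp (- c * x)" "0 < c"
  shows "Bochner_Integration.simple_bochner_integrable (lebesgue_on {0..}) (right_step i f)"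
    and "(\<lambda>i. Bochner_Integration.simple_bochner_integral (lebesgue_on {0..}) (right_step i f))
      \<longlonglongrightarrow> Bochner_int (lebesgue_on {0..}) f"
    and "has_Bochner_int (lebesgue_on {0..}) f (Bochner_int (lebesgue_on {0..}) f)"
proof -
  have i: "integrable (lebesgue_on {0..}) (\<lambda>x::real. C * exp (- c * x))"
    using integrable_exp_neg[OF assms(3)] by (rule integrable_mult_right)
  have t: "(\<lambda>i. right_step i f x) \<longlonglongrightarrow> f x" if "x \<in> space (lebesgue_on {0..})" for x
    using that assms(1) by (simp add: right_step_tendsto)
  have b: "norm (right_step i f x) \<le> C * exp (- c * x)" if "x \<in> space (lebesgue_on {0..})" for i x
    using that right_step_le[OF assms(2), of x i] assms(3) by simp
  note * = has_Bochner_int_dominated[OF simple_function_right_step t i b]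
  show "Bochner_Integration.simple_bochner_integrable (lebesgue_on {0..}) (right_step i f)"
    and "(\<lambda>i. Bochner_Integration.simple_bochner_integral (lebesgue_on {0..}) (right_step i f))
      \<longlonglongrightarrow> Bochner_int (lebesgue_on {0..}) f"
    and "has_Bochner_int (lebesgue_on {0..}) f (Bochner_int (lebesgue_on {0..}) f)"
    by (rule *; assumption)+
qed

text \<open>The approximating step functions depend linearly on the function, which yields the linearity
  of the integral without a general theory of strongly measurable functions.\<close>

lemma Bochner_int_add:
  fixes f g :: "real \<Rightarrow> 'b::banach"
  assumes f: "right_continuous f" "\<And>x. 0 \<le> x \<Longrightarrow> norm (f x) \<le> C * exp (- c * x)" "0 < c"
    and g: "right_continuous g" "\<And>x. 0 \<le> x \<Longrightarrow> norm (g x) \<le> C' * exp (- c * x)"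
  shows "Bochner_int (lebesgue_on {0..}) (\<lambda>x. f x + g x)
    = Bochner_int (lebesgue_on {0..}) f + Bochner_int (lebesgue_on {0..}) g"
proof -
  let ?I = "Bochner_Integration.simple_bochner_integral (lebesgue_on {0..})"
  note F = right_continuous_has_Bochner_int[OF f]
  note G = right_continuous_has_Bochner_int[OF g f(3)]
  have rc: "right_continuous (\<lambda>x. f x + g x)"
    using f(1) g(1) unfolding right_continuous_def by (auto intro!: tendsto_add)
  have "norm (f x + g x) \<le> (C + C') * exp (- c * x)" if "0 \<le> x" for x
    using norm_triangle_le[OF add_mono[OF f(2)[OF that] g(2)[OF that]]] by (simp add: distrib_right)
  note FG = right_continuous_has_Bochner_int[OF rc this f(3)]
  have "right_step i (\<lambda>x. f x + g x) = (\<lambda>x. right_step i f x + right_step i g x)" for i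
    by (auto simp: right_step_def)
  then have "?I (right_step i (\<lambda>x. f x + g x)) = ?I (right_step i f) + ?I (right_step i g)" for i
    using simple_bochner_integral_add[OF F(1) G(1)] by simp
  then show ?thesis
    using LIMSEQ_unique[OF FG(2)] tendsto_add[OF F(2) G(2)] by simp
qed

text \<open>On real functions the two notions of integral share the approximation clause; Borel
  measurability follows since \<open>f\<close> is a limit of step functions. This carries the
  computed integral of the Wright function over to \<open>S_op\<close>.\<close>

lemma Bochner_int_real:
  fixes f :: "real \<Rightarrow> real"
  assumes "right_continuous f" "\<And>x. 0 \<le> x \<Longrightarrow> norm (f x) \<le> C * exp (- c * x)" "0 < c"
  shows "Bochner_int (lebesgue_on {0..}) f = integral\<^sup>L (lebesgue_on {0..}) f"
proof -
  have "f \<in> borel_measurable (lebesgue_on {0..})"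
    by (rule borel_measurable_LIMSEQ_real[where u="\<lambda>i. right_step i f"])
      (auto intro: right_step_tendsto assms borel_measurable_simple_function simple_function_right_step)
  then have "has_bochner_integral (lebesgue_on {0..}) f (Bochner_int (lebesgue_on {0..}) f)"
    using right_continuous_has_Bochner_int(3)[OF assms]
    unfolding has_bochner_integral.simps has_Bochner_int_def by auto
  then show ?thesis by (simp add: has_bochner_integral_integral_eq)
qed

lemma Bochner_int_scaleR_left:
  fixes y :: "'b::banach"
  assumes f: "right_continuous f" "\<And>x. 0 \<le> x \<Longrightarrow> norm (f x) \<le> C * exp (- c * x)" "0 < c"
  shows "Bochner_int (lebesgue_on {0..}) (\<lambda>x. f x *\<^sub>R y) = integral\<^sup>L (lebesgue_on {0..}) f *\<^sub>R y"
proof -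
  let ?I = "Bochner_Integration.simple_bochner_integral (lebesgue_on {0..})"
  note F = right_continuous_has_Bochner_int[OF f]
  have rc: "right_continuous (\<lambda>x. f x *\<^sub>R y)"
    using f(1) unfolding right_continuous_def by (auto intro!: tendsto_intros)
  have "norm (f x *\<^sub>R y) \<le> (C * norm y) * exp (- c * x)" if "0 \<le> x" for x
    using mult_right_mono[OF f(2)[OF that], of "norm y"] by (simp add: mult_ac)
  note FY = right_continuous_has_Bochner_int[OF rc this f(3)]
  have "right_step i (\<lambda>x. f x *\<^sub>R y) = (\<lambda>x. right_step i f x *\<^sub>R y)" for i
    by (auto simp: right_step_def)
  then have "?I (right_step i (\<lambda>x. f x *\<^sub>R y)) = ?I (right_step i f) *\<^sub>R y" for i
    using simple_bochner_integral_linear[OF _ F(1), where f="\<lambda>r. r *\<^sub>R y"]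
    by (simp add: bounded_linear.linear bounded_linear_scaleR_left)
  moreover have "(\<lambda>i. ?I (right_step i f) *\<^sub>R y) \<longlonglongrightarrow> Bochner_int (lebesgue_on {0..}) f *\<^sub>R y"
    by (intro tendsto_intros F)
  ultimately show ?thesis
    using LIMSEQ_unique[OF FY(2)] Bochner_int_real[OF f] by simp
qed

section \<open>Hankel's integral for the reciprocal Gamma function\<close>

lemma integrable_exp_dominated:
  fixes g :: "real \<Rightarrow> 'b::{banach, second_countable_topology}"
  assumes "continuous_on {0..} g" "0 < c" "\<And>r. 0 \<le> r \<Longrightarrow> norm (g r) \<le> C * exp (- c * r)"
  shows "integrable (lebesgue_on {0..}) g"
proof (rule Bochner_Integration.integrable_bound)
  show "integrable (lebesgue_on {0..}) (\<lambda>x::real. C * exp (- c * x))"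
    by (intro integrable_mult_right integrable_exp_neg assms)
  show "g \<in> borel_measurable (lebesgue_on {0..})"
    by (intro continuous_imp_measurable_on_sets_lebesgue assms) simp
  show "AE x in lebesgue_on {0..}. norm (g x) \<le> norm (C * exp (- c * x))"
    using assms(3) by (intro AE_I2) (metis abs_ge_self atLeast_iff order_trans real_norm_def space_lebesgue_on)
qed

text \<open>A bridge between two integrals: the fundamental theorem of calculus and contour
  integration produce gauge integrals over [0, N], while dominated convergence is applied to
  Lebesgue integrals over [0, oo).\<close>

lemma integral_Icc_tendsto:
  fixes f :: "real \<Rightarrow> 'b::euclidean_space"
  assumes "integrable (lebesgue_on {0..}) f"
  shows "((\<lambda>N. integral {0..N} f) \<longlongrightarrow> integral\<^sup>L (lebesgue_on {0..}) f) at_top"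
proof -
  have f: "set_integrable lebesgue {0..} f"
    using assms by (simp add: set_integrable_def integrable_restrict_space)
  have "((\<lambda>N. set_lebesgue_integral lebesgue {0..N} f)
      \<longlongrightarrow> set_lebesgue_integral lebesgue {0..} f) at_top"
    by (rule tendsto_set_lebesgue_integral_at_top[OF _ f]) simp
  moreover have "set_lebesgue_integral lebesgue {0..N} f = integral {0..N} f" for N
    by (intro set_lebesgue_integral_eq_integral(2) set_integrable_subset[OF f]) auto
  ultimately show ?thesis
    by (simp add: set_lebesgue_integral_def integral_restrict_space)
qed

text \<open>As \<alpha> < 1, the term X t^\<alpha> is eventually below any positive linear term, and
  compactness covers the rest. Staying above \<rho> > 0 matters for negative \<open>q\<close>, where
  t^q blows up at 0.\<close>

lemma powr_exp_powr_le_exp: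
  fixes q X \<alpha> \<epsilon> \<rho> :: real
  assumes "\<alpha> < 1" "0 < \<epsilon>" "0 < \<rho>"
  obtains C where "\<And>t. \<rho> \<le> t \<Longrightarrow> t powr q * exp (X * t powr \<alpha>) \<le> C * exp (\<epsilon> * t)"
proof -
  define g where "g t = t powr q * exp (X * t powr \<alpha> - \<epsilon> * t)" for t
  have "(g \<longlongrightarrow> 0) at_top"
    unfolding g_def using assms by real_asymp
  then have "\<forall>\<^sub>F t in at_top. g t < 1" by (rule order_tendstoD) simp
  then obtain T where T: "\<And>t. T \<le> t \<Longrightarrow> g t < 1" by (auto simp: eventually_at_top_linorder)
  have "continuous_on {\<rho>..T} g"
    unfolding g_def using assms by (intro continuous_intros) auto
  then have "bounded (g ` {\<rho>..T})"
    by (intro compact_imp_bounded compact_continuous_image) auto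
  then obtain D where D: "\<And>t. t \<in> {\<rho>..T} \<Longrightarrow> \<bar>g t\<bar> \<le> D"
    unfolding bounded_iff by (metis imageI real_norm_def)
  have "g t \<le> \<bar>D\<bar> + 1" if "\<rho> \<le> t" for t
    using that T[of t] D[of t] by (cases "T \<le> t") force+
  moreover have "t powr q * exp (X * t powr \<alpha>) = g t * exp (\<epsilon> * t)" for t
    by (simp add: g_def exp_diff)
  ultimately have "t powr q * exp (X * t powr \<alpha>) \<le> (\<bar>D\<bar> + 1) * exp (\<epsilon> * t)" if "\<rho> \<le> t" for t
    using that by (metis exp_ge_zero mult_right_mono)
  then show ?thesis by (rule that)
qed

text \<open>An angle above pi/2 makes exp decay along the ray; an angle below pi keeps the ray off
  the cut of the principal power.\<close>

locale hankel_ray =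
  fixes R \<phi> :: real
  assumes R_pos: "0 < R" and \<phi>_gt: "pi / 2 < \<phi>" and \<phi>_lt: "\<phi> < pi"
begin

text \<open>The upper half of a Hankel contour around the negative axis. Since the integrands take conjugate
  values at conjugate points, the imaginary part of the integral over this ray recovers the full
  contour integral.\<close>

definition ray :: "real \<Rightarrow> complex" where "ray r = of_real R + of_real r * cis \<phi>"

lemma sin_\<phi>_pos: "0 < sin \<phi>"
  using \<phi>_gt \<phi>_lt by (intro sin_gt_zero) auto

lemma cos_\<phi>_neg: "cos \<phi> < 0"
proof -
  have "cos \<phi> < cos (pi / 2)"
    using \<phi>_gt \<phi>_lt by (intro cos_monotone_0_pi) auto
  then show ?thesis by simp
qed

lemma Re_ray: "Re (ray r) = R + r * cos \<phi>" and Im_ray: "Im (ray r) = r * sin \<phi>"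
  by (simp_all add: ray_def)

lemma ray_0 [simp]: "ray 0 = of_real R"
  by (simp add: ray_def)

lemma ray_not_nonpos_Reals: "0 \<le> r \<Longrightarrow> ray r \<notin> \<real>\<^sub>\<le>\<^sub>0"
  using R_pos sin_\<phi>_pos by (cases "r = 0") (auto simp: complex_nonpos_Reals_iff Re_ray Im_ray)

lemma ray_nonzero: "0 \<le> r \<Longrightarrow> ray r \<noteq> 0"
  using ray_not_nonpos_Reals by fastforce

lemma norm_ray_le: "0 \<le> r \<Longrightarrow> norm (ray r) \<le> R + r"
  unfolding ray_def using R_pos norm_triangle_ineq[of "of_real R" "of_real r * cis \<phi>"]
  by (simp add: norm_mult)

lemma norm_exp_ray: "norm (exp (ray r)) = exp (R + r * cos \<phi>)"
  by (simp add: Re_ray)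

text \<open>Sine rule in the triangle 0, R, \<open>ray r\<close>: both sides are the distance from 0
  to the line carrying the ray, read off as an imaginary part after rotation by - \<phi>.\<close>

lemma norm_ray_sin: "norm (ray r) * sin (\<phi> - Arg (ray r)) = R * sin \<phi>"
proof -
  have "ray r = norm (ray r) * cis (Arg (ray r))"
    by (metis rcis_cmod_Arg rcis_def)
  then have "ray r * cis (- \<phi>) = norm (ray r) * cis (Arg (ray r) - \<phi>)"
    by (metis cis_mult mult.assoc diff_conv_add_uminus)
  then have "Im (ray r * cis (- \<phi>)) = norm (ray r) * sin (Arg (ray r) - \<phi>)"
    by simp
  moreover have "Im (ray r * cis (- \<phi>)) = - R * sin \<phi>"
    by (simp add: Re_ray Im_ray algebra_simps)
  moreover have "sin (\<phi> - Arg (ray r)) = - sin (Arg (ray r) - \<phi>)"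
    by (metis minus_diff_eq sin_minus)
  ultimately show ?thesis by simp
qed

lemma norm_ray_ge: "R * sin \<phi> \<le> norm (ray r)"
  unfolding norm_ray_sin[of r, symmetric] by (rule mult_left_le) auto

text \<open>If the argument reached \<phi>, the left side of \<open>norm_ray_sin\<close> would be
  nonpositive. The bound will keep the argument of s^\<alpha> below \<alpha> \<phi>.\<close>

lemma Arg_ray: assumes "0 \<le> r" shows "0 \<le> Arg (ray r)" "Arg (ray r) < \<phi>"
proof -
  show "0 \<le> Arg (ray r)"
    using assms sin_\<phi>_pos by (simp add: Arg_less_0 Im_ray)
  show "Arg (ray r) < \<phi>"
  proof (rule ccontr)
    assume "\<not> Arg (ray r) < \<phi>"
    then have "0 \<le> sin (Arg (ray r) - \<phi>)"
      using \<phi>_gt \<phi>_lt Arg_le_pi[of "ray r"] by (intro sin_ge_zero) auto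
    moreover have "sin (\<phi> - Arg (ray r)) = - sin (Arg (ray r) - \<phi>)"
      by (metis minus_diff_eq sin_minus)
    ultimately have "norm (ray r) * sin (\<phi> - Arg (ray r)) \<le> 0"
      by (simp add: mult_nonneg_nonpos)
    moreover have "0 < R * sin \<phi>" using R_pos sin_\<phi>_pos by simp
    ultimately show False by (simp add: norm_ray_sin)
  qed
qed

lemma continuous_on_ray [continuous_intros]: "continuous_on A ray"
  unfolding ray_def by (intro continuous_intros)

lemma ray_has_vector_derivative: "(ray has_vector_derivative cis \<phi>) (at r within A)"
  unfolding ray_def
  by (auto intro!: derivative_eq_intros simp: has_vector_derivative_def scaleR_conv_of_real)

lemma continuous_on_ray_powr [continuous_intros]:
  "continuous_on {0..} (\<lambda>r. ray r powr w)"
  by (intro continuous_on_powr_complex continuous_intros)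
    (use R_pos sin_\<phi>_pos in \<open>auto simp: Re_ray Im_ray ray_nonzero\<close>)

text \<open>The exponential decays at rate - cos \<phi>. Half of that rate absorbs the power and the
  factor exp (X |s|^\<alpha>); the other half survives.\<close>

lemma exp_ray_dominated:
  fixes q X \<alpha> :: real
  assumes "\<alpha> < 1"
  obtains C where "\<And>r. 0 \<le> r \<Longrightarrow>
    norm (exp (ray r)) * (norm (ray r) powr q * exp (X * norm (ray r) powr \<alpha>)) \<le> C * exp (- (- cos \<phi> / 2) * r)"
proof -
  define \<kappa> where "\<kappa> = - cos \<phi>"
  have \<kappa>: "0 < \<kappa>" using cos_\<phi>_neg by (simp add: \<kappa>_def)
  obtain C where C: "\<And>t. R * sin \<phi> \<le> t \<Longrightarrow> t powr q * exp (X * t powr \<alpha>) \<le> C * exp (\<kappa> / 2 * t)"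
    using powr_exp_powr_le_exp[OF assms, of "\<kappa> / 2" "R * sin \<phi>" q X] \<kappa> R_pos sin_\<phi>_pos by auto
  have C0: "0 \<le> C"
  proof -
    have "0 \<le> C * exp (\<kappa> / 2 * (R * sin \<phi>))"
      using C[of "R * sin \<phi>"] by (smt (verit) exp_gt_zero mult_nonneg_nonneg powr_ge_zero)
    then show ?thesis by (simp add: zero_le_mult_iff)
  qed
  have "norm (exp (ray r)) * (norm (ray r) powr q * exp (X * norm (ray r) powr \<alpha>))
      \<le> (C * exp (R + \<kappa> / 2 * R)) * exp (- (- cos \<phi> / 2) * r)" if r: "0 \<le> r" for r
  proof -
    have "norm (ray r) powr q * exp (X * norm (ray r) powr \<alpha>) \<le> C * exp (\<kappa> / 2 * norm (ray r))"
      by (rule C[OF norm_ray_ge])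
    also have "\<dots> \<le> C * exp (\<kappa> / 2 * (R + r))"
      using C0 \<kappa> norm_ray_le[OF r] by (intro mult_left_mono) auto
    finally have "norm (exp (ray r)) * (norm (ray r) powr q * exp (X * norm (ray r) powr \<alpha>))
        \<le> norm (exp (ray r)) * (C * exp (\<kappa> / 2 * (R + r)))"
      by (rule mult_left_mono) simp
    also have "norm (exp (ray r)) * (C * exp (\<kappa> / 2 * (R + r)))
        = exp (R - \<kappa> * r) * (C * exp (\<kappa> / 2 * (R + r)))"
      unfolding norm_exp_ray \<kappa>_def by (simp add: mult.commute)
    also have "exp (R - \<kappa> * r) * (C * exp (\<kappa> / 2 * (R + r))) = C * exp ((R - \<kappa> * r) + (\<kappa> / 2 * (R + r)))"
      unfolding exp_add by simp
    also have "(R - \<kappa> * r) + (\<kappa> / 2 * (R + r)) = (R + \<kappa> / 2 * R) + - (- cos \<phi> / 2) * r"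
      by (simp add: \<kappa>_def field_simps)
    finally show ?thesis unfolding exp_add by (simp only: mult.assoc)
  qed
  then show ?thesis by (rule that)
qed

lemma integrable_exp_ray:
  fixes q X \<alpha> C :: real and g :: "real \<Rightarrow> complex"
  assumes "\<alpha> < 1" "continuous_on {0..} g"
    and "\<And>r. 0 \<le> r \<Longrightarrow> norm (g r) \<le> C * (norm (ray r) powr q * exp (X * norm (ray r) powr \<alpha>))"
  shows "integrable (lebesgue_on {0..}) (\<lambda>r. cis \<phi> * (exp (ray r) * g r))"
proof -
  obtain D where D: "\<And>r. 0 \<le> r \<Longrightarrow> norm (exp (ray r)) * (norm (ray r) powr q * exp (X * norm (ray r) powr \<alpha>))
      \<le> D * exp (- (- cos \<phi> / 2) * r)"
    using exp_ray_dominated[OF assms(1)] by metis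
  show ?thesis
  proof (rule integrable_exp_dominated)
    show "0 < - cos \<phi> / 2" using cos_\<phi>_neg by simp
    show "continuous_on {0..} (\<lambda>r. cis \<phi> * (exp (ray r) * g r))"
      by (intro continuous_intros assms)
    fix r :: real assume r: "0 \<le> r"
    have "norm (cis \<phi> * (exp (ray r) * g r)) = norm (exp (ray r)) * norm (g r)"
      by (simp add: norm_mult)
    also have "\<dots> \<le> norm (exp (ray r)) *
        (\<bar>C\<bar> * (norm (ray r) powr q * exp (X * norm (ray r) powr \<alpha>)))"
      using assms(3)[OF r] by (intro mult_left_mono order_trans[OF assms(3)[OF r]] mult_right_mono) auto
    also have "\<dots> \<le> \<bar>C\<bar> * (D * exp (- (- cos \<phi> / 2) * r))"
      using mult_left_mono[OF D[OF r], of "\<bar>C\<bar>"] by (simp add: mult_ac)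
    finally show "norm (cis \<phi> * (exp (ray r) * g r)) \<le> \<bar>C\<bar> * D * exp (- (- cos \<phi> / 2) * r)"
      by (simp add: mult_ac)
  qed
qed

lemma integrable_exp_ray_powr:
  "integrable (lebesgue_on {0..}) (\<lambda>r. cis \<phi> * (exp (ray r) * ray r powr of_real q))"
  by (rule integrable_exp_ray[where \<alpha>=0 and C=1 and X=0 and q=q])
    (auto intro!: continuous_intros simp: norm_powr_real_powr')

text \<open>Hankel's formula writes 1/Gamma (z) as 1/(2 pi i) times the integral of exp s * s^(-z)
  over the full contour, so the expected value is pi/Gamma (z). The factor \<open>cis \<phi>\<close>
  is ds/dr.\<close>

definition hankel :: "real \<Rightarrow> real" where
  "hankel z = Im (integral\<^sup>L (lebesgue_on {0..}) (\<lambda>r. cis \<phi> * (exp (ray r) * ray r powr of_real (- z))))"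

text \<open>Integration by parts: the derivative of exp s * s^(-z) along the ray integrates to minus
  its value at the vertex R, which is real and so drops out of the imaginary part. This is the
  recursion of 1/Gamma.\<close>

lemma hankel_rec: "hankel z = z * hankel (z + 1)"
proof -
  let ?h = "\<lambda>z r. cis \<phi> * (exp (ray r) * ray r powr of_real (- z))"
  let ?F = "\<lambda>r. exp (ray r) * ray r powr of_real (- z)"
  let ?D = "\<lambda>r. ?h z r - of_real z * ?h (z + 1) r"
  have deriv: "(?F has_vector_derivative ?D r) (at r within {0..N})" if "0 \<le> r" for r N
  proof -
    have "((\<lambda>w. exp w * w powr of_real (- z)) has_field_derivative
        (exp (ray r) * ray r powr of_real (- z)
          + exp (ray r) * (of_real (- z) * ray r powr (of_real (- z) - 1)))) (at (ray r))"
      using ray_not_nonpos_Reals[OF that] by (auto intro!: derivative_eq_intros)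
    from field_vector_diff_chain_within[OF ray_has_vector_derivative has_field_derivative_at_within[OF this]]
    have "(?F has_vector_derivative (cis \<phi> * (exp (ray r) * ray r powr of_real (- z)
          + exp (ray r) * (of_real (- z) * ray r powr (of_real (- z) - 1))))) (at r within {0..N})"
      by (simp add: o_def)
    moreover have "(of_real (- (z + 1)) :: complex) = of_real (- z) - 1" by simp
    then have "cis \<phi> * (exp (ray r) * ray r powr of_real (- z)
          + exp (ray r) * (of_real (- z) * ray r powr (of_real (- z) - 1))) = ?D r"
      by (simp only: of_real_minus) (simp add: ring_distribs)
    ultimately show ?thesis by simp
  qed
  have int: "integrable (lebesgue_on {0..}) ?D"
    by (intro Bochner_Integration.integrable_diff integrable_mult_right integrable_exp_ray_powr)
  have "(?F \<longlongrightarrow> 0) at_top"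
  proof -
    obtain C where C: "\<And>r. 0 \<le> r \<Longrightarrow>
        norm (exp (ray r)) * (norm (ray r) powr (- z) * exp (0 * norm (ray r) powr 0)) \<le> C * exp (- (- cos \<phi> / 2) * r)"
      using exp_ray_dominated[of 0 "- z" 0] by auto
    show ?thesis
    proof (rule Lim_null_comparison)
      show "\<forall>\<^sub>F r in at_top. norm (?F r) \<le> C * exp (- (- cos \<phi> / 2) * r)"
        using eventually_ge_at_top[of 0]
        by eventually_elim (use C in \<open>simp add: norm_mult norm_powr_real_powr'\<close>)
      show "((\<lambda>r. C * exp (- (- cos \<phi> / 2) * r)) \<longlongrightarrow> 0) at_top"
        using cos_\<phi>_neg by real_asymp
    qed
  qed
  then have "((\<lambda>N. ?F N - ?F 0) \<longlongrightarrow> 0 - ?F 0) at_top"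
    by (intro tendsto_intros)
  moreover have "\<forall>\<^sub>F N in at_top. ?F N - ?F 0 = integral {0..N} ?D"
    using eventually_ge_at_top[of 0]
  proof eventually_elim
    case (elim N)
    then have "(?D has_integral (?F N - ?F 0)) {0..N}"
      by (intro fundamental_theorem_of_calculus deriv) auto
    then show ?case by (simp add: integral_unique)
  qed
  ultimately have "((\<lambda>N. integral {0..N} ?D) \<longlongrightarrow> 0 - ?F 0) at_top"
    by (rule Lim_transform_eventually)
  then have "integral\<^sup>L (lebesgue_on {0..}) ?D = 0 - ?F 0"
    using integral_Icc_tendsto[OF int] tendsto_unique trivial_limit_at_top_linorder by blast
  then have "Im (integral\<^sup>L (lebesgue_on {0..}) ?D) = 0"
    using R_pos by (simp add: powr_of_real Im_exp flip: of_real_minus)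
  moreover have "integral\<^sup>L (lebesgue_on {0..}) ?D = integral\<^sup>L (lebesgue_on {0..}) (?h z)
      - of_real z * integral\<^sup>L (lebesgue_on {0..}) (?h (z + 1))"
    by (simp only: Bochner_Integration.integral_diff[OF integrable_exp_ray_powr
          integrable_mult_right[OF integrable_exp_ray_powr]] integral_mult_right_zero)
  ultimately show ?thesis unfolding hankel_def by simp
qed

end

section \<open>Euler's integral and the value of Hankel's integral\<close>

lemma integrable_Gamma_integrand:
  assumes "0 < x"
  shows "integrable (lebesgue_on {0..}) (\<lambda>t::real. t powr (x - 1) / exp t)"
    and "integral\<^sup>L (lebesgue_on {0..}) (\<lambda>t::real. t powr (x - 1) / exp t) = Gamma x"
proof -
  have "(\<lambda>t::real. t powr (x - 1) / exp t) absolutely_integrable_on {0..}"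
    by (rule nonnegative_absolutely_integrable_1)
      (use Gamma_integral_real[OF assms] in \<open>auto simp: integrable_on_def\<close>)
  then show 1: "integrable (lebesgue_on {0..}) (\<lambda>t::real. t powr (x - 1) / exp t)"
    by (simp add: set_integrable_def integrable_restrict_space)
  show "integral\<^sup>L (lebesgue_on {0..}) (\<lambda>t::real. t powr (x - 1) / exp t) = Gamma x"
    by (rule has_integral_unique[OF has_integral_integral_lebesgue_on[OF 1] Gamma_integral_real[OF assms]])
      simp
qed

text \<open>The principal power is continuous up to the negative axis from above. Multiplication by
  -i turns the closed upper half plane into the closed right half plane, away from the cut; a
  constant factor undoes the rotation, and p > 0 settles the origin.\<close>

lemma continuous_on_powr_upper_half_plane:
  assumes "0 < p"
  shows "continuous_on {w. 0 \<le> Im w} (\<lambda>w. w powr complex_of_real p)"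
proof -
  have "continuous_on {w. 0 \<le> Im w} (\<lambda>w. (- \<i> * w) powr complex_of_real p * exp (\<i> * (pi / 2 * p)))"
    using assms by (intro continuous_intros) auto
  moreover have "(- \<i> * w) powr complex_of_real p * exp (\<i> * (pi / 2 * p)) = w powr complex_of_real p"
    if "0 \<le> Im w" for w
  proof (cases "w = 0")
    case False
    have "Ln (\<i> * (- \<i> * w)) = Ln (- \<i> * w) + \<i> * of_real pi / 2"
      using False that by (subst Ln_times_ii) auto
    then have L: "Ln w = Ln (- \<i> * w) + \<i> * of_real pi / 2" by simp
    show ?thesis
      using False unfolding powr_def L by (simp add: exp_add [symmetric] algebra_simps)
  qed simp
  ultimately show ?thesis by (subst continuous_on_cong[OF refl]) auto
qed

lemma Im_exp_powr_of_real:
  "Im (exp (of_real x) * of_real x powr complex_of_real p)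
    = (if x < 0 then sin (pi * p) * ((- x) powr p / exp (- x)) else 0)"
  by (simp add: powr_of_real_if Im_exp Re_exp exp_minus field_simps cis_conv_exp[symmetric] mult.commute
      flip: exp_of_real)

context hankel_ray
begin

lemma contour_integral_ray:
  assumes "continuous_on (closed_segment (of_real R) (ray N)) f" "0 < N"
  shows "contour_integral (linepath (of_real R) (ray N)) f = integral {0..N} (\<lambda>r. cis \<phi> * f (ray r))"
proof -
  have "contour_integral (linepath (of_real R) (ray N)) f
      = contour_integral (linepath 0 (of_real N)) (\<lambda>w. f (of_real R + w * cis \<phi>) * cis \<phi>)"
    unfolding contour_integral_integral
    by (rule integral_cong) (simp add: linepath_def ray_def algebra_simps scaleR_conv_of_real)
  also have "\<dots> = integral {0..N} (\<lambda>r. cis \<phi> * f (ray r))"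
    using assms(2) by (subst contour_integral_linepath_Reals_eq) (auto simp: ray_def mult.commute)
  finally show ?thesis .
qed

text \<open>Cauchy's theorem on the triangle with vertices \<open>- N\<close>, \<open>R\<close>, \<open>ray N\<close> moves the ray onto the negative
  axis, where the integral becomes Euler's integral for \<open>Gamma (1 + p)\<close>.\<close>

lemma hankel_neg:
  assumes p: "0 < p"
  shows "hankel (- p) = pi * rGamma (- p)"
proof -
  let ?f = "\<lambda>w. exp w * w powr complex_of_real p"
  let ?g = "\<lambda>t. t powr ((1 + p) - 1) / exp t"
  let ?h = "\<lambda>r. cis \<phi> * (exp (ray r) * ray r powr of_real p)"
  define b where "b N = contour_integral (linepath (ray N) (- of_real N)) ?f" for N
  have UH: "convex {w. 0 \<le> Im w}"
    using convex_halfspace_Im_ge[of 0] by simp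
  have cont: "continuous_on {w. 0 \<le> Im w} ?f"
    by (intro continuous_intros continuous_on_powr_upper_half_plane p)
  have vert: "- of_real N \<in> {w. 0 \<le> Im w}" "of_real R \<in> {w. 0 \<le> Im w}" "ray N \<in> {w. 0 \<le> Im w}"
    if "0 < N" for N
    using that sin_\<phi>_pos by (auto simp: Im_ray)
  have split: "integral {0..N} ?h
      = - integral {- N..R} (\<lambda>x. exp (of_real x) * of_real x powr complex_of_real p) - b N"
    if N: "0 < N" for N
  proof -
    have hull: "convex hull {- of_real N, of_real R, ray N} \<subseteq> {w. 0 \<le> Im w}"
      using vert[OF N] UH by (intro hull_minimal) auto
    have seg: "closed_segment (- of_real N) (of_real R) \<subseteq> {w. 0 \<le> Im w}"
      "closed_segment (of_real R) (ray N) \<subseteq> {w. 0 \<le> Im w}"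
      "closed_segment (ray N) (- of_real N) \<subseteq> {w. 0 \<le> Im w}"
      by (intro closed_segment_subset vert[OF N] UH)+
    \<comment> \<open>One side of the triangle runs along the branch cut, so holomorphy is available
      only in the interior; up to the boundary there is continuity.\<close>
    have "?f holomorphic_on interior (convex hull {- of_real N, of_real R, ray N})"
    proof -
      have "interior (convex hull {- of_real N, of_real R, ray N}) \<subseteq> interior {w. Im w \<ge> 0}"
        by (rule interior_mono[OF hull])
      also have "\<dots> = {w. 0 < Im w}"
        using interior_halfspace_ge[of \<i> 0] by (simp add: inner_complex_def)
      finally have "interior (convex hull {- of_real N, of_real R, ray N}) \<subseteq> - \<real>\<^sub>\<le>\<^sub>0"
        by (auto simp: complex_nonpos_Reals_iff)
      then show ?thesis by (intro holomorphic_intros) auto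
    qed
    then have "(?f has_contour_integral 0) (linepath (- of_real N) (of_real R) +++
        linepath (of_real R) (ray N) +++ linepath (ray N) (- of_real N))"
      by (intro Cauchy_theorem_triangle_interior continuous_on_subset[OF cont hull])
    moreover have "?f contour_integrable_on linepath (- of_real N) (of_real R)"
      "?f contour_integrable_on linepath (of_real R) (ray N)"
      "?f contour_integrable_on linepath (ray N) (- of_real N)"
      by (intro contour_integrable_continuous_linepath continuous_on_subset[OF cont] seg)+
    ultimately have "contour_integral (linepath (- of_real N) (of_real R)) ?f
        + (contour_integral (linepath (of_real R) (ray N)) ?f + b N) = 0"
      unfolding b_def
      by (auto dest!: contour_integral_unique simp: contour_integrable_joinI)
    moreover have "contour_integral (linepath (- of_real N) (of_real R)) ?f
        = integral {- N..R} (\<lambda>x. exp (of_real x) * of_real x powr complex_of_real p)"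
      using N R_pos by (subst contour_integral_linepath_Reals_eq) auto
    moreover have "contour_integral (linepath (of_real R) (ray N)) ?f = integral {0..N} ?h"
      by (intro contour_integral_ray continuous_on_subset[OF cont] seg N)
    moreover have "Y = - X - c" if "A + (B + c) = 0" "A = X" "B = Y" for A B c X Y :: complex
      using that by (metis add.commute add.assoc add_eq_0_iff diff_conv_add_uminus add_uminus_conv_diff minus_add_distrib)
    ultimately show ?thesis by blast
  qed
  \<comment> \<open>Only the negative part of the axis contributes: there the argument is pi, and x
    = - t gives Euler's integrand. On [0, R] the integrand is real.\<close>
  have neg: "Im (integral {- N..R} (\<lambda>x. exp (of_real x) * of_real x powr complex_of_real p))
      = sin (pi * p) * integral {0..N} ?g" if N: "0 < N" for N
  proof -
    let ?k = "\<lambda>x. exp (of_real x) * of_real x powr complex_of_real p"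
    let ?G = "\<lambda>x. if x < 0 then sin (pi * p) * ((- x) powr p / exp (- x)) else 0"
    have "continuous_on {- N..R} (?f \<circ> complex_of_real)"
      by (rule continuous_on_compose[OF _ continuous_on_subset[OF cont]]) (auto intro!: continuous_intros)
    then have int: "?k integrable_on {- N..R}"
      by (intro integrable_continuous_real) (simp add: o_def)
    have "Im (integral {- N..R} ?k) = integral {- N..R} (\<lambda>x. Im (?k x))"
      using integral_linear[OF int bounded_linear_Im] by (simp add: o_def)
    also have "\<dots> = integral {- N..R} ?G"
      by (simp only: Im_exp_powr_of_real)
    also have "\<dots> = integral {- N..0} ?G + integral {0..R} ?G"
    proof (rule Henstock_Kurzweil_Integration.integral_combine[symmetric])
      have "(\<lambda>x. Im (?k x)) integrable_on {- N..R}"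
        using integrable_linear[OF int bounded_linear_Im] by (simp add: o_def)
      then show "?G integrable_on {- N..R}"
        by (simp only: Im_exp_powr_of_real)
    qed (use N R_pos in auto)
    also have "integral {0..R} ?G = integral {0..R} (\<lambda>_. 0)"
      by (rule integral_cong) auto
    also have "integral {- N..0} ?G = integral {- N..- 0} (\<lambda>x. sin (pi * p) * ?g (- x))"
      by (simp only: minus_zero, rule integral_cong) auto
    also have "\<dots> = integral {0..N} (\<lambda>t. sin (pi * p) * ?g t)"
      by (rule Henstock_Kurzweil_Integration.integral_reflect_real[where f="\<lambda>t. sin (pi * p) * ?g t"])
    also have "\<dots> = sin (pi * p) * integral {0..N} ?g"
      by (rule Henstock_Kurzweil_Integration.integral_mult_right)
    finally show ?thesis by simp
  qed
  \<comment> \<open>On the closing side the real part is at most R + N cos \<phi>, its value at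
    \<open>ray N\<close>, so the exponential beats the power and the length.\<close>
  have "(b \<longlongrightarrow> 0) at_top"
  proof (rule Lim_null_comparison)
    show "\<forall>\<^sub>F N in at_top. norm (b N) \<le> (exp (R + N * cos \<phi>) * (R + N) powr p) * (2 * (R + N))"
      using eventually_ge_at_top[of 1]
    proof eventually_elim
      case (elim N)
      then have N: "0 < N" by simp
      have seg: "closed_segment (ray N) (- of_real N) \<subseteq> {w. 0 \<le> Im w}"
        using vert[OF N] UH by (intro closed_segment_subset) auto
      have "norm (b N) \<le> (exp (R + N * cos \<phi>) * (R + N) powr p) * norm (- of_real N - ray N)"
        unfolding b_def
      proof (rule has_contour_integral_bound_linepath[OF has_contour_integral_integral])
        show "?f contour_integrable_on linepath (ray N) (- of_real N)"
          by (intro contour_integrable_continuous_linepath continuous_on_subset[OF cont] seg)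
        fix w assume w: "w \<in> closed_segment (ray N) (- of_real N)"
        have "closed_segment (ray N) (- of_real N) \<subseteq> {w. Re w \<le> R + N * cos \<phi>}"
        proof (rule closed_segment_subset)
          have "- N \<le> N * cos \<phi>"
            using mult_left_mono[OF cos_ge_minus_one[of \<phi>], of N] N by simp
          then show "- of_real N \<in> {w. Re w \<le> R + N * cos \<phi>}" using R_pos by simp
        qed (auto simp: Re_ray convex_halfspace_Re_le)
        then have "norm (exp w) \<le> exp (R + N * cos \<phi>)" using w by auto
        moreover have "closed_segment (ray N) (- of_real N) \<subseteq> cball 0 (R + N)"
          using norm_ray_le[of N] R_pos N by (intro closed_segment_subset) auto
        then have "norm (w powr of_real p) \<le> (R + N) powr p"
          using w p by (auto simp: norm_powr_real_powr' intro!: powr_mono2)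
        ultimately show "norm (?f w) \<le> exp (R + N * cos \<phi>) * (R + N) powr p"
          unfolding norm_mult by (intro mult_mono) auto
      qed auto
      also have "norm (- of_real N - ray N) \<le> 2 * (R + N)"
        using norm_triangle_ineq4[of "- of_real N" "ray N"] norm_ray_le[of N] R_pos N by simp
      finally show ?case by (simp add: mult_left_mono)
    qed
    show "((\<lambda>N. (exp (R + N * cos \<phi>) * (R + N) powr p) * (2 * (R + N))) \<longlongrightarrow> 0) at_top"
      using cos_\<phi>_neg by real_asymp
  qed
  then have "((\<lambda>N. - (sin (pi * p) * integral {0..N} ?g) - Im (b N))
      \<longlongrightarrow> - (sin (pi * p) * Gamma (1 + p)) - Im 0) at_top"
    using integral_Icc_tendsto[OF integrable_Gamma_integrand(1), of "1 + p"]
      integrable_Gamma_integrand(2)[of "1 + p"] p by (intro tendsto_intros) auto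
  moreover have "\<forall>\<^sub>F N in at_top. - (sin (pi * p) * integral {0..N} ?g) - Im (b N) = Im (integral {0..N} ?h)"
    using eventually_gt_at_top[of 0] by eventually_elim (simp only: split minus_complex.sel uminus_complex.sel neg)
  ultimately have "((\<lambda>N. Im (integral {0..N} ?h)) \<longlongrightarrow> - (sin (pi * p) * Gamma (1 + p)) - Im 0) at_top"
    by (rule Lim_transform_eventually)
  moreover have "((\<lambda>N. Im (integral {0..N} ?h)) \<longlongrightarrow> hankel (- p)) at_top"
    unfolding hankel_def minus_minus
    by (intro tendsto_Im integral_Icc_tendsto integrable_exp_ray_powr)
  ultimately have "hankel (- p) = - (sin (pi * p) * Gamma (1 + p))"
    using tendsto_unique[OF trivial_limit_at_top_linorder] by fastforce
  \<comment> \<open>The reflection formula turns - sin (pi p) Gamma (1 + p) into pi/Gamma (- p).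
    With \<open>rGamma\<close> in product form it also covers integral p, where both sides
    vanish.\<close>
  moreover have "rGamma (- p) * rGamma (1 + p) = - sin (pi * p) / pi"
  proof -
    have "complex_of_real (rGamma (- p) * rGamma (1 + p))
        = rGamma (of_real (- p)) * rGamma (of_real (1 + p))"
      by (simp only: of_real_mult rGamma_complex_of_real)
    also have "complex_of_real (1 + p) = 1 - of_real (- p)" by simp
    also have "rGamma (of_real (- p)) * rGamma (1 - complex_of_real (- p))
        = sin (of_real pi * of_real (- p)) / of_real pi"
      by (rule rGamma_reflection_complex)
    also have "\<dots> = of_real (sin (pi * - p) / pi)"
      by (simp only: of_real_mult [symmetric] sin_of_real of_real_divide)
    also have "sin (pi * - p) = - sin (pi * p)" by simp
    finally have "complex_of_real (rGamma (- p) * rGamma (1 + p)) = complex_of_real (- sin (pi * p) / pi)" .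
    then show ?thesis by (simp only: of_real_eq_iff)
  qed
  moreover have "rGamma (1 + p) * Gamma (1 + p) = 1"
    unfolding rGamma_inverse_Gamma
    by (rule left_inverse) (use p Gamma_real_pos[of "1 + p"] in linarith)
  moreover have "h = pi * r" if "h = - (s * G)" "r * q = - s / pi" "q * G = 1" for h s G r q :: real
  proof -
    have "pi * r = pi * (r * q) * G" using that(3) by simp
    also have "\<dots> = h" using that by simp
    finally show ?thesis by simp
  qed
  ultimately show ?thesis by blast
qed

text \<open>The recursion at \<open>z = 0\<close> gives no information about \<open>hankel 1\<close>, so the value at 1 is reached by
  continuity.\<close>

lemma hankel_1_limit: "(\<lambda>n. hankel (1 - 1 / real (Suc n))) \<longlonglongrightarrow> hankel 1"
  unfolding hankel_def
proof (intro tendsto_Im integral_dominated_convergence)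
  let ?h = "\<lambda>z r. cis \<phi> * (exp (ray r) * ray r powr of_real (- z))"
  \<comment> \<open>With \<rho> = R sin \<phi> and 0 \<le> z \<le> 1, the power \<rho>^(-z) is at
    most the maximum of 1 and 1/\<rho>, hence at most this constant.\<close>
  let ?C = "1 + 1 / (R * sin \<phi>)"
  have \<rho>: "0 < R * sin \<phi>" using R_pos sin_\<phi>_pos by simp
  show "?h 1 \<in> borel_measurable (lebesgue_on {0..})"
    "?h (1 - 1 / real (Suc n)) \<in> borel_measurable (lebesgue_on {0..})" for n
    by (intro borel_measurable_integrable integrable_exp_ray_powr)+
  show "integrable (lebesgue_on {0..}) (\<lambda>r. ?C * norm (cis \<phi> * (exp (ray r) * ray r powr of_real 0)))"
    by (intro integrable_mult_right integrable_norm integrable_exp_ray_powr)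
  show "AE r in lebesgue_on {0..}. norm (?h (1 - 1 / real (Suc n)) r)
      \<le> ?C * norm (cis \<phi> * (exp (ray r) * ray r powr of_real 0))" for n
  proof (intro AE_I2)
    fix r assume "r \<in> space (lebesgue_on {0::real..})"
    then have r: "0 \<le> r" by simp
    define z where "z = 1 - 1 / real (Suc n)"
    have z: "0 \<le> z" "z \<le> 1" by (auto simp: z_def)
    have "norm (ray r) powr (- z) \<le> (R * sin \<phi>) powr (- z)"
      using \<rho> z norm_ray_ge[of r] by (intro powr_mono2') auto
    also have "\<dots> \<le> ?C"
    proof (cases "1 \<le> R * sin \<phi>")
      case True
      then have "(R * sin \<phi>) powr (- z) \<le> (R * sin \<phi>) powr 0" using z by (intro powr_mono) auto
      also have "\<dots> = 1" using R_pos sin_\<phi>_pos by simp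
      also have "1 \<le> ?C" using \<rho> by simp
      finally show ?thesis .
    next
      case False
      then have "(R * sin \<phi>) powr (- z) \<le> (R * sin \<phi>) powr (- 1)" using z \<rho> by (intro powr_mono') auto
      also have "\<dots> = 1 / (R * sin \<phi>)" using \<rho> by (simp add: powr_minus_divide)
      finally show ?thesis by simp
    qed
    finally have "norm (ray r) powr (- z) \<le> ?C" .
    then show "norm (?h (1 - 1 / real (Suc n)) r)
        \<le> ?C * norm (cis \<phi> * (exp (ray r) * ray r powr of_real 0))"
      unfolding z_def[symmetric] using ray_nonzero[OF r]
      by (simp add: norm_mult norm_powr_real_powr' mult.commute mult_left_mono del: norm_exp_eq_Re)
  qed
  show "AE r in lebesgue_on {0..}. (\<lambda>n. ?h (1 - 1 / real (Suc n)) r) \<longlonglongrightarrow> ?h 1 r"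
  proof (intro AE_I2)
    fix r assume "r \<in> space (lebesgue_on {0::real..})"
    then have r: "ray r \<notin> \<real>\<^sub>\<le>\<^sub>0" by (simp add: ray_not_nonpos_Reals)
    have "(\<lambda>n. - (1 - 1 / real (Suc n))) \<longlonglongrightarrow> - (1 - 0)"
      by (intro tendsto_intros LIMSEQ_Suc[OF lim_1_over_n])
    then have "(\<lambda>n. - (1 - 1 / real (Suc n))) \<longlonglongrightarrow> - 1" by simp
    with r show "(\<lambda>n. ?h (1 - 1 / real (Suc n)) r) \<longlonglongrightarrow> ?h 1 r"
      by (intro tendsto_mult tendsto_const tendsto_powr_complex tendsto_of_real)
  qed
qed

text \<open>The contour shift settles z < 0; at z = 0 the recursion makes both sides vanish; one
  recursion step from z - 1 handles 0 < z < 1; continuity gives z = 1.\<close>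

lemma hankel_eq_rGamma:
  assumes "z \<le> 1"
  shows "hankel z = pi * rGamma z"
proof -
  have lt: "hankel z = pi * rGamma z" if "z < 1" for z
  proof (cases "z \<le> 0")
    case True
    then show ?thesis
      using hankel_neg[of "- z"] hankel_rec[of 0] by (cases "z = 0") auto
  next
    case False
    then have "(z - 1) * hankel z = pi * rGamma (z - 1)"
      using hankel_neg[of "1 - z"] hankel_rec[of "z - 1"] that by simp
    moreover have "rGamma (z - 1) = (z - 1) * rGamma z"
      using rGamma_plus1[of "z - 1"] by simp
    ultimately show ?thesis using that by simp
  qed
  show ?thesis
  proof (cases "z = 1")
    case True
    have "(\<lambda>n. 1 - 1 / real (Suc n)) \<longlonglongrightarrow> 1 - 0"
      by (intro tendsto_intros LIMSEQ_Suc[OF lim_1_over_n])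
    moreover have "isCont (rGamma :: real \<Rightarrow> real) 1"
      using continuous_on_rGamma[of "UNIV :: real set"] by (simp add: continuous_on_eq_continuous_at)
    ultimately have "(\<lambda>n. pi * rGamma (1 - 1 / real (Suc n))) \<longlonglongrightarrow> pi * rGamma 1"
      unfolding diff_0_right by (intro tendsto_mult_left isCont_tendsto_compose[where g=rGamma])
    moreover have "(\<lambda>n. pi * rGamma (1 - 1 / real (Suc n))) \<longlonglongrightarrow> hankel 1"
      using hankel_1_limit lt by simp
    ultimately show ?thesis unfolding True by (rule LIMSEQ_unique[symmetric])
  qed (use lt assms in auto)
qed

end

section \<open>The Wright function\<close>

lemma norm_exp_partial_sum_le:
  fixes w :: complex
  shows "norm (\<Sum>m<n. w ^ m / fact m) \<le> exp (norm w)"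
proof -
  have "norm (\<Sum>m<n. w ^ m / fact m) \<le> (\<Sum>m<n. norm w ^ m /\<^sub>R fact m)"
    by (rule sum_norm_le) (simp add: norm_mult norm_inverse norm_power divide_inverse mult.commute)
  also have "\<dots> \<le> (\<Sum>m. norm w ^ m /\<^sub>R fact m)"
    by (intro sum_le_suminf summable_exp_generic) auto
  finally show ?thesis by (simp add: exp_def)
qed

section \<open>Integral representation of the Wright function\<close>

context hankel_ray
begin

definition wright_integral :: "real \<Rightarrow> real \<Rightarrow> real \<Rightarrow> real" where
  "wright_integral \<alpha> \<mu> X = Im (integral\<^sup>L (lebesgue_on {0..}) (\<lambda>r. cis \<phi> * (exp (ray r) *
     (ray r powr of_real (- \<mu>) * exp (- of_real X * ray r powr of_real \<alpha>))))) / pi"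

lemma integrable_wright_integrand:
  assumes "\<alpha> < 1"
  shows "integrable (lebesgue_on {0..}) (\<lambda>r. cis \<phi> * (exp (ray r) *
     (ray r powr of_real (- \<mu>) * exp (- of_real X * ray r powr of_real \<alpha>))))"
proof (rule integrable_exp_ray[OF assms, where C=1 and q="- \<mu>" and X="\<bar>X\<bar>"])
  show "continuous_on {0..} (\<lambda>r. ray r powr of_real (- \<mu>) * exp (- of_real X * ray r powr of_real \<alpha>))"
    by (intro continuous_intros)
  fix r :: real
  have "norm (exp (- of_real X * ray r powr of_real \<alpha>)) \<le> exp (norm (- of_real X * ray r powr of_real \<alpha>))"
    by (rule norm_exp)
  then show "norm (ray r powr of_real (- \<mu>) * exp (- of_real X * ray r powr of_real \<alpha>))
      \<le> 1 * (norm (ray r) powr (- \<mu>) * exp (\<bar>X\<bar> * norm (ray r) powr \<alpha>))"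
    by (simp add: norm_mult norm_powr_real_powr' mult_left_mono del: norm_exp_eq_Re)
qed

text \<open>Expanding exp (- X s^\<alpha>) produces Hankel integrals at \<mu> - \<alpha> m. The
  partial sums are dominated by exp (|X| |s|^\<alpha>), which exp s absorbs on the ray because
  \<alpha> < 1. Convergence of the series everywhere comes as a by-product.\<close>

lemma wright_series_sums:
  assumes "\<alpha> < 1" "0 \<le> \<alpha>" "\<mu> \<le> 1"
  shows "(\<lambda>m. (- X) ^ m / fact m * rGamma (\<mu> - \<alpha> * real m)) sums wright_integral \<alpha> \<mu> X"
proof -
  define w where "w r = - of_real X * ray r powr of_real \<alpha>" for r
  define G where "G n r = cis \<phi> * (exp (ray r) * (ray r powr of_real (- \<mu>) * (\<Sum>m<n. w r ^ m / fact m)))" for n r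
  let ?h = "\<lambda>z r. cis \<phi> * (exp (ray r) * ray r powr of_real (- z))"
  have cont_w: "continuous_on {0..} w"
    unfolding w_def by (intro continuous_intros)
  have norm_w: "norm (w r) = \<bar>X\<bar> * norm (ray r) powr \<alpha>" for r
    by (simp add: w_def norm_mult norm_powr_real_powr')
  have int: "integrable (lebesgue_on {0..}) (\<lambda>r. cis \<phi> * (exp (ray r) *
      (ray r powr of_real (- \<mu>) * of_real (exp (norm (w r))))))"
    by (rule integrable_exp_ray[OF assms(1), where C=1 and q="- \<mu>" and X="\<bar>X\<bar>"])
      (auto intro!: continuous_intros cont_w simp: norm_mult norm_powr_real_powr' norm_w ray_nonzero)
  have G_int: "integrable (lebesgue_on {0..}) (G n)" for n
    unfolding G_def
  proof (rule integrable_exp_ray[OF assms(1), where C=1 and q="- \<mu>" and X="\<bar>X\<bar>"])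
    show "continuous_on {0..} (\<lambda>r. ray r powr of_real (- \<mu>) * (\<Sum>m<n. w r ^ m / fact m))"
      by (intro continuous_intros cont_w) auto
    show "norm (ray r powr of_real (- \<mu>) * (\<Sum>m<n. w r ^ m / fact m))
        \<le> 1 * (norm (ray r) powr (- \<mu>) * exp (\<bar>X\<bar> * norm (ray r) powr \<alpha>))" for r
      using norm_exp_partial_sum_le[where w="w r" and n=n]
      by (simp add: norm_mult norm_powr_real_powr' norm_w mult_left_mono)
  qed
  have coeff: "of_real (a m) * ?h (\<mu> - \<alpha> * real m) r
      = cis \<phi> * (exp (ray r) * (ray r powr of_real (- \<mu>) * (w r ^ m / fact m)))"
    if "0 \<le> r" "a m = (- X) ^ m / fact m" for a m r
  proof -
    have "(ray r powr of_real \<alpha>) ^ m = ray r powr (of_nat m * of_real \<alpha>)"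
      using ray_nonzero[OF that(1)] by (simp add: powr_def exp_of_nat_mult [symmetric] mult.assoc)
    moreover have "complex_of_real (- (\<mu> - \<alpha> * real m)) = of_real (- \<mu>) + of_nat m * of_real \<alpha>"
      by simp
    ultimately have "ray r powr of_real (- (\<mu> - \<alpha> * real m))
        = ray r powr of_real (- \<mu>) * (ray r powr of_real \<alpha>) ^ m"
      by (simp only: powr_add)
    then show ?thesis
      unfolding that(2) w_def by (simp add: power_mult_distrib flip: of_real_minus)
  qed
  have partial: "(\<Sum>m<n. (- X) ^ m / fact m * rGamma (\<mu> - \<alpha> * real m))
      = Im (integral\<^sup>L (lebesgue_on {0..}) (G n)) / pi" for n
  proof -
    have "(\<Sum>m<n. (- X) ^ m / fact m * rGamma (\<mu> - \<alpha> * real m))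
        = (\<Sum>m<n. (- X) ^ m / fact m * (hankel (\<mu> - \<alpha> * real m) / pi))"
    proof (rule sum.cong[OF refl])
      fix m
      have "0 \<le> \<alpha> * real m" using assms by simp
      then have "\<mu> - \<alpha> * real m \<le> 1" using assms(3) by linarith
      then show "(- X) ^ m / fact m * rGamma (\<mu> - \<alpha> * real m)
          = (- X) ^ m / fact m * (hankel (\<mu> - \<alpha> * real m) / pi)"
        by (simp add: hankel_eq_rGamma)
    qed
    also have "\<dots> = Im (\<Sum>m<n. of_real ((- X) ^ m / fact m)
        * integral\<^sup>L (lebesgue_on {0..}) (?h (\<mu> - \<alpha> * real m))) / pi"
      unfolding Im_sum sum_divide_distrib hankel_def
      by (intro sum.cong refl) (simp only: Im_complex_of_real Re_complex_of_real times_complex.sel, simp)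
    also have "(\<Sum>m<n. of_real ((- X) ^ m / fact m) * integral\<^sup>L (lebesgue_on {0..}) (?h (\<mu> - \<alpha> * real m)))
        = integral\<^sup>L (lebesgue_on {0..}) (\<lambda>r. \<Sum>m<n. of_real ((- X) ^ m / fact m) * ?h (\<mu> - \<alpha> * real m) r)"
      by (subst Bochner_Integration.integral_sum)
        (intro integrable_mult_right integrable_exp_ray_powr, simp only: integral_mult_right_zero)
    also have "\<dots> = integral\<^sup>L (lebesgue_on {0..}) (G n)"
    proof (rule Bochner_Integration.integral_cong[OF refl])
      fix r assume "r \<in> space (lebesgue_on {0::real..})"
      then have "0 \<le> r" by simp
      then show "(\<Sum>m<n. of_real ((- X) ^ m / fact m) * ?h (\<mu> - \<alpha> * real m) r) = G n r"
        unfolding G_def sum_distrib_left by (intro sum.cong refl coeff[where a="\<lambda>m. (- X) ^ m / fact m"]) auto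
    qed
    finally show ?thesis .
  qed
  have "(\<lambda>n. integral\<^sup>L (lebesgue_on {0..}) (G n)) \<longlonglongrightarrow> integral\<^sup>L (lebesgue_on {0..})
      (\<lambda>r. cis \<phi> * (exp (ray r) * (ray r powr of_real (- \<mu>) * exp (w r))))"
  proof (rule integral_dominated_convergence[OF _ _ integrable_norm[OF int]])
    show "(\<lambda>r. cis \<phi> * (exp (ray r) * (ray r powr of_real (- \<mu>) * exp (w r)))) \<in> borel_measurable (lebesgue_on {0..})"
      unfolding w_def by (intro borel_measurable_integrable integrable_wright_integrand assms)
    show "G n \<in> borel_measurable (lebesgue_on {0..})" for n
      by (intro borel_measurable_integrable G_int)
    show "AE r in lebesgue_on {0..}. norm (G n r)
        \<le> norm (cis \<phi> * (exp (ray r) * (ray r powr of_real (- \<mu>) * of_real (exp (norm (w r))))))" for n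
      using norm_exp_partial_sum_le by (intro AE_I2) (auto simp: G_def norm_mult intro!: mult_left_mono)
    have "(\<lambda>n. \<Sum>m<n. w r ^ m / fact m) \<longlonglongrightarrow> exp (w r)" for r
      using exp_converges[of "w r"] unfolding sums_def
      by (simp add: scaleR_conv_of_real divide_inverse mult.commute)
    then show "AE r in lebesgue_on {0..}. (\<lambda>n. G n r)
        \<longlonglongrightarrow> cis \<phi> * (exp (ray r) * (ray r powr of_real (- \<mu>) * exp (w r)))"
      unfolding G_def by (intro AE_I2 tendsto_mult_left)
  qed
  then show ?thesis
    unfolding sums_def partial wright_integral_def w_def by (intro tendsto_intros) auto
qed

text \<open>Re (s^\<alpha>) = |s|^\<alpha> cos (\<alpha> Arg s); along the ray |s| \<ge> R sin
  \<phi> and the argument stays below \<phi>. The remaining factor is integrable and free of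
  X.\<close>

lemma wright_integral_bound:
  assumes "0 < \<alpha>" "\<alpha> < 1" "\<alpha> * \<phi> < pi / 2"
  obtains K where "\<And>X. 0 \<le> X \<Longrightarrow>
    \<bar>wright_integral \<alpha> \<mu> X\<bar> \<le> K * exp (- (cos (\<alpha> * \<phi>) * (R * sin \<phi>) powr \<alpha>) * X)"
proof -
  define c where "c = cos (\<alpha> * \<phi>) * (R * sin \<phi>) powr \<alpha>"
  define J where "J = integral\<^sup>L (lebesgue_on {0..}) (\<lambda>r. norm (cis \<phi> * (exp (ray r) * ray r powr of_real (- \<mu>))))"
  have \<phi>0: "0 < \<phi>" using \<phi>_gt pi_gt_zero by linarith
  have "\<bar>wright_integral \<alpha> \<mu> X\<bar> \<le> (J / pi) * exp (- c * X)" if X: "0 \<le> X" for X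
  proof -
    let ?F = "\<lambda>r. cis \<phi> * (exp (ray r) * (ray r powr of_real (- \<mu>) * exp (- of_real X * ray r powr of_real \<alpha>)))"
    have "norm (integral\<^sup>L (lebesgue_on {0..}) ?F) \<le> integral\<^sup>L (lebesgue_on {0..})
        (\<lambda>r. norm (cis \<phi> * (exp (ray r) * ray r powr of_real (- \<mu>))) * exp (- c * X))"
    proof (rule Bochner_Integration.integral_norm_bound_integral)
      show "integrable (lebesgue_on {0..}) ?F"
        by (rule integrable_wright_integrand[OF assms(2)])
      show "integrable (lebesgue_on {0..})
          (\<lambda>r. norm (cis \<phi> * (exp (ray r) * ray r powr of_real (- \<mu>))) * exp (- c * X))"
        by (intro integrable_mult_left integrable_norm integrable_exp_ray_powr)
      fix r assume "r \<in> space (lebesgue_on {0::real..})"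
      then have r: "0 \<le> r" by simp
      have "\<alpha> * \<phi> \<le> pi" using assms(3) pi_gt_zero by linarith
      then have "cos (\<alpha> * \<phi>) \<le> cos (\<alpha> * Arg (ray r))"
        using Arg_ray[OF r] assms \<phi>0 by (intro cos_monotone_0_pi_le) (auto intro!: mult_left_mono)
      moreover have "0 \<le> cos (\<alpha> * \<phi>)"
        using assms \<phi>0 by (intro cos_ge_zero) (auto intro: order_trans[of _ 0])
      moreover have "(R * sin \<phi>) powr \<alpha> \<le> norm (ray r) powr \<alpha>"
        using norm_ray_ge[of r] R_pos sin_\<phi>_pos assms by (intro powr_mono2) auto
      ultimately have "c \<le> cos (\<alpha> * Arg (ray r)) * norm (ray r) powr \<alpha>"
        unfolding c_def by (intro mult_mono) auto
      also have "\<dots> = Re (ray r powr of_real \<alpha>)"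
        using ray_nonzero[OF r]
        by (simp add: powr_def Re_exp Arg_eq_Im_Ln [symmetric] mult.commute)
      finally have "norm (exp (- of_real X * ray r powr of_real \<alpha>)) \<le> exp (- c * X)"
        using X by (simp add: mult.commute mult_left_mono)
      then show "norm (?F r) \<le> norm (cis \<phi> * (exp (ray r) * ray r powr of_real (- \<mu>))) * exp (- c * X)"
        unfolding norm_mult mult.assoc by (intro mult_left_mono) (auto simp del: norm_exp_eq_Re)
    qed
    also have "\<dots> = J * exp (- c * X)"
      unfolding J_def by (rule integral_mult_left_zero)
    finally show ?thesis
      unfolding wright_integral_def
      using abs_Im_le_cmod[of "integral\<^sup>L (lebesgue_on {0..}) ?F"] by (simp add: divide_right_mono)
  qed
  then show ?thesis unfolding c_def by (rule that)
qed

end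

text \<open>The classical Wright function with parameters - \<alpha> and \<mu>, evaluated at -
  \<theta>.\<close>

definition wright_fun :: "real \<Rightarrow> real \<Rightarrow> real \<Rightarrow> real" where
  "wright_fun \<alpha> \<mu> \<theta> = (\<Sum>m. (- \<theta>) ^ m / fact m * rGamma (\<mu> - \<alpha> * real m))"

lemma wright_conv_wright_fun: "wright \<alpha> = wright_fun \<alpha> (1 - \<alpha>)"
  by (simp add: fun_eq_iff wright_def wright_fun_def algebra_simps)

context
  fixes \<alpha> :: real
  assumes \<alpha>: "0 < \<alpha>" "\<alpha> < 1"
begin

text \<open>The angle pi/(1 + \<alpha>) lies in (pi/2, pi), and \<alpha> times it is below pi/2,
  both by 0 < \<alpha> < 1.\<close>

lemma hankel_ray_alpha: "0 < R \<Longrightarrow> hankel_ray R (pi / (1 + \<alpha>))"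
  using \<alpha> by unfold_locales (auto simp: field_simps)

lemma wright_fun_summable: "\<mu> \<le> 1 \<Longrightarrow> summable (\<lambda>m. (- \<theta>) ^ m / fact m * rGamma (\<mu> - \<alpha> * real m))"
  using hankel_ray.wright_series_sums[OF hankel_ray_alpha[of 1], of \<alpha> \<mu> \<theta>] \<alpha> by (simp add: sums_iff)

text \<open>The sum of the series is independent of the vertex R, while the rate cos (\<alpha>
  \<phi>) (R sin \<phi>)^\<alpha> is unbounded in R for a fixed angle.\<close>

lemma wright_fun_decay:
  assumes "\<mu> \<le> 1"
  obtains K where "\<And>\<theta>. 0 \<le> \<theta> \<Longrightarrow> \<bar>wright_fun \<alpha> \<mu> \<theta>\<bar> \<le> K * exp (- \<omega> * \<theta>)"
proof -
  define \<phi> where "\<phi> = pi / (1 + \<alpha>)"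
  have \<phi>: "pi / 2 < \<phi>" "\<phi> < pi" "\<alpha> * \<phi> < pi / 2" "0 < \<alpha> * \<phi>"
    using \<alpha> by (auto simp: \<phi>_def field_simps)
  have c: "0 < cos (\<alpha> * \<phi>)" using \<phi> by (intro cos_gt_zero) auto
  have s: "0 < sin \<phi>" using \<phi> \<alpha> by (intro sin_gt_zero) (auto simp: \<phi>_def)
  \<comment> \<open>Once (R sin \<phi>)^\<alpha> equals \<open>q\<close>, the decay rate is
    |\<omega>| + 1, which exceeds \<omega>.\<close>
  define q where "q = (\<bar>\<omega>\<bar> + 1) / cos (\<alpha> * \<phi>)"
  have q: "0 < q" using c by (simp add: q_def)
  \<comment> \<open>The contour does not depend on \<open>R\<close>; moving it to the right makes the decay rate arbitrarily large.\<close>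
  define R where "R = q powr (1 / \<alpha>) / sin \<phi>"
  have R: "0 < R" using s q by (simp add: R_def)
  interpret hankel_ray R \<phi> using R \<phi> by unfold_locales
  have "R * sin \<phi> = q powr (1 / \<alpha>)" using s by (simp add: R_def)
  then have "(R * sin \<phi>) powr \<alpha> = q" using q \<alpha> by (simp add: powr_powr)
  then have e: "cos (\<alpha> * \<phi>) * (R * sin \<phi>) powr \<alpha> = \<bar>\<omega>\<bar> + 1" using c by (simp add: q_def)
  obtain K where K: "\<And>X. 0 \<le> X \<Longrightarrow> \<bar>wright_integral \<alpha> \<mu> X\<bar> \<le> K * exp (- (\<bar>\<omega>\<bar> + 1) * X)"
    using wright_integral_bound[OF \<alpha> \<phi>(3), of \<mu>] unfolding e by metis
  have "\<bar>wright_fun \<alpha> \<mu> \<theta>\<bar> \<le> K * exp (- \<omega> * \<theta>)" if "0 \<le> \<theta>" for \<theta>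
  proof -
    have K0: "0 \<le> K"
      using order_trans[OF abs_ge_zero K[of 0]] by simp
    have "wright_fun \<alpha> \<mu> \<theta> = wright_integral \<alpha> \<mu> \<theta>"
      unfolding wright_fun_def using wright_series_sums[of \<alpha> \<mu> \<theta>] \<alpha> assms by (simp add: sums_iff)
    then have "\<bar>wright_fun \<alpha> \<mu> \<theta>\<bar> \<le> K * exp (- (\<bar>\<omega>\<bar> + 1) * \<theta>)"
      using K[OF that] by simp
    also have "- (\<bar>\<omega>\<bar> + 1) * \<theta> \<le> - \<omega> * \<theta>"
      using that by (intro mult_right_mono) auto
    then have "K * exp (- (\<bar>\<omega>\<bar> + 1) * \<theta>) \<le> K * exp (- \<omega> * \<theta>)"
      using K0 by (intro mult_left_mono) auto
    finally show ?thesis .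
  qed
  then show ?thesis by (rule that)
qed

section \<open>Derivative and total integral of the Wright function\<close>

definition wright_coeff :: "real \<Rightarrow> nat \<Rightarrow> real" where
  "wright_coeff \<mu> m = (- 1) ^ m / fact m * rGamma (\<mu> - \<alpha> * real m)"

lemma wright_coeff_power:
  "(- \<theta>) ^ m / fact m * rGamma (\<mu> - \<alpha> * real m) = wright_coeff \<mu> m * \<theta> ^ m"
  unfolding wright_coeff_def by (subst power_minus) simp

lemma wright_fun_powser: "wright_fun \<alpha> \<mu> \<theta> = (\<Sum>m. wright_coeff \<mu> m * \<theta> ^ m)"
  unfolding wright_fun_def wright_coeff_power ..

lemma summable_wright_coeff: "\<mu> \<le> 1 \<Longrightarrow> summable (\<lambda>m. wright_coeff \<mu> m * \<theta> ^ m)"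
  using wright_fun_summable unfolding wright_coeff_power .

lemma isCont_wright_fun: "\<mu> \<le> 1 \<Longrightarrow> isCont (wright_fun \<alpha> \<mu>) \<theta>"
  unfolding wright_fun_powser[abs_def]
  by (intro isCont_powser_converges_everywhere summable_wright_coeff)

lemma wright_fun_has_field_derivative:
  assumes "\<mu> \<le> 1"
  shows "(wright_fun \<alpha> \<mu> has_field_derivative - wright_fun \<alpha> (\<mu> - \<alpha>) \<theta>) (at \<theta>)"
proof -
  have "((\<lambda>x. \<Sum>m. wright_coeff \<mu> m * x ^ m) has_field_derivative
      (\<Sum>m. diffs (wright_coeff \<mu>) m * \<theta> ^ m)) (at \<theta>)"
    by (intro termdiffs_strong_converges_everywhere summable_wright_coeff assms)
  moreover have "diffs (wright_coeff \<mu>) m * \<theta> ^ m = - (wright_coeff (\<mu> - \<alpha>) m * \<theta> ^ m)" for m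
  proof -
    have "\<mu> - \<alpha> * real (Suc m) = \<mu> - \<alpha> - \<alpha> * real m" by (simp add: algebra_simps)
    then have "diffs (wright_coeff \<mu>) m = - wright_coeff (\<mu> - \<alpha>) m"
      unfolding diffs_def wright_coeff_def by (simp add: field_simps del: of_nat_Suc)
    then show ?thesis by simp
  qed
  moreover have "(\<Sum>m. - (wright_coeff (\<mu> - \<alpha>) m * \<theta> ^ m)) = - (\<Sum>m. wright_coeff (\<mu> - \<alpha>) m * \<theta> ^ m)"
    using assms \<alpha> by (intro suminf_minus summable_wright_coeff) auto
  ultimately show ?thesis
    unfolding wright_fun_powser[abs_def] by simp
qed

lemma wright_fun_0: "wright_fun \<alpha> \<mu> 0 = rGamma \<mu>"
  unfolding wright_fun_powser powser_zero by (simp add: wright_coeff_def)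

lemma isCont_wright: "isCont (wright \<alpha>) \<theta>"
  unfolding wright_conv_wright_fun using \<alpha> by (intro isCont_wright_fun) auto

lemma wright_decay:
  obtains K where "\<And>\<theta>. 0 \<le> \<theta> \<Longrightarrow> \<bar>wright \<alpha> \<theta>\<bar> \<le> K * exp (- \<omega> * \<theta>)"
  using wright_fun_decay[of "1 - \<alpha>" \<omega>] \<alpha> unfolding wright_conv_wright_fun by auto

text \<open>An antiderivative is \<open>- wright_fun \<alpha> 1\<close>, which tends to 0 at
  infinity by the decay estimate and equals - 1/Gamma (1) = - 1 at 0.\<close>

lemma integral_wright: "integral\<^sup>L (lebesgue_on {0..}) (wright \<alpha>) = 1"
proof -
  obtain K where K: "\<And>\<theta>. 0 \<le> \<theta> \<Longrightarrow> \<bar>wright \<alpha> \<theta>\<bar> \<le> K * exp (- 1 * \<theta>)"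
    using wright_decay[where \<omega>=1] by blast
  have "integrable (lebesgue_on {0..}) (wright \<alpha>)"
    by (rule integrable_exp_dominated[where c=1 and C=K])
      (use K isCont_wright in \<open>auto intro: continuous_at_imp_continuous_on\<close>)
  note * = integral_Icc_tendsto[OF this]
  obtain L where L: "\<And>\<theta>. 0 \<le> \<theta> \<Longrightarrow> \<bar>wright_fun \<alpha> 1 \<theta>\<bar> \<le> L * exp (- 1 * \<theta>)"
    using wright_fun_decay[where \<mu>=1 and \<omega>=1] by blast
  have "(wright_fun \<alpha> 1 \<longlongrightarrow> 0) at_top"
  proof (rule Lim_null_comparison)
    show "\<forall>\<^sub>F \<theta> in at_top. norm (wright_fun \<alpha> 1 \<theta>) \<le> L * exp (- 1 * \<theta>)"
      using eventually_ge_at_top[of 0] by eventually_elim (use L in auto)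
    show "((\<lambda>\<theta>. L * exp (- 1 * \<theta>)) \<longlongrightarrow> 0) at_top" by real_asymp
  qed
  then have "((\<lambda>N. wright_fun \<alpha> 1 0 - wright_fun \<alpha> 1 N) \<longlongrightarrow> 1 - 0) at_top"
    unfolding wright_fun_0 rGamma_1 by (intro tendsto_intros)
  moreover have "\<forall>\<^sub>F N in at_top. wright_fun \<alpha> 1 0 - wright_fun \<alpha> 1 N = integral {0..N} (wright \<alpha>)"
    using eventually_ge_at_top[of 0]
  proof eventually_elim
    case (elim N)
    have "((\<lambda>\<theta>. - wright_fun \<alpha> 1 \<theta>) has_vector_derivative wright \<alpha> \<theta>) (at \<theta> within {0..N})" for \<theta>
      unfolding wright_conv_wright_fun has_real_derivative_iff_has_vector_derivative[symmetric]
      using DERIV_minus[OF wright_fun_has_field_derivative[of 1 \<theta>]]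
      by (auto intro: has_field_derivative_at_within)
    from fundamental_theorem_of_calculus[OF elim this] show ?case
      by (simp add: integral_unique)
  qed
  ultimately have "((\<lambda>N. integral {0..N} (wright \<alpha>)) \<longlongrightarrow> 1 - 0) at_top"
    by (rule Lim_transform_eventually)
  with * show ?thesis
    using tendsto_unique[OF trivial_limit_at_top_linorder] by fastforce
qed

end

section \<open>Mild solutions\<close>

text \<open>S (x + h) y = S x (S h y), and continuity of the single operator \<open>S x\<close>
  suffices; left limits would call for a local bound on the whole family.\<close>

lemma C0_semigroup_right_continuous:
  assumes "C0_semigroup S"
  shows "right_continuous (\<lambda>t. S t y)"
  unfolding right_continuous_def
proof (intro allI impI)
  fix x :: real assume "0 \<le> x"
  have "((\<lambda>h. S x (S h y)) \<longlongrightarrow> S x y) (at_right 0)"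
    using assms unfolding C0_semigroup_def by (intro tendsto_intros) auto
  moreover have "\<forall>\<^sub>F h in at_right 0. S x (S h y) = S (h + x) y"
    using eventually_at_right_less
  proof eventually_elim
    case (elim h)
    have "S (x + h) = S x o\<^sub>L S h"
      using assms \<open>0 \<le> x\<close> elim unfolding C0_semigroup_def by simp
    then show ?case by (simp add: add.commute)
  qed
  ultimately have "((\<lambda>h. S (h + x) y) \<longlongrightarrow> S x y) (at_right 0)"
    by (rule Lim_transform_eventually)
  then show "((\<lambda>t. S t y) \<longlongrightarrow> S x y) (at_right x)"
    by (subst filterlim_at_right_to_0)
qed

text \<open>The rate may depend on the vector, so the uniform boundedness principle is not needed.\<close>

lemma C0_semigroup_exp_bound:
  assumes "C0_semigroup S"
  obtains K \<omega> where "\<And>t. 0 \<le> t \<Longrightarrow> norm (S t y) \<le> K * exp (\<omega> * t)"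
proof -
  have S0: "S 0 = id_blinfun" and S_add: "\<And>s t. 0 \<le> s \<Longrightarrow> 0 \<le> t \<Longrightarrow> S (s + t) = S s o\<^sub>L S t"
    and lim: "((\<lambda>t. S t y) \<longlongrightarrow> y) (at_right 0)"
    using assms unfolding C0_semigroup_def by auto
  define K where "K = norm y + 1"
  have "\<forall>\<^sub>F t in at_right 0. norm (S t y) < K"
    using tendsto_norm[OF lim] by (rule order_tendstoD) (simp add: K_def)
  then obtain \<delta> where \<delta>: "0 < \<delta>" "\<And>t. 0 < t \<Longrightarrow> t < \<delta> \<Longrightarrow> norm (S t y) < K"
    unfolding eventually_at_right_field by auto
  define d where "d = \<delta> / 2"
  have d: "0 < d" "d < \<delta>" using \<delta> by (auto simp: d_def)
  have small: "norm (S r y) \<le> K" if "0 \<le> r" "r \<le> d" for r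
    using that \<delta>(2)[of r] d by (cases "r = 0") (auto simp: S0 K_def)
  \<comment> \<open>At least 1, so that ln m \<ge> 0 and the number n of steps may be replaced by
    the larger t/d.\<close>
  define m where "m = max 1 (norm (S d))"
  have m: "1 \<le> m" "norm (S d) \<le> m" by (auto simp: m_def)
  have step: "norm (S (real n * d + r) y) \<le> m ^ n * K" if "0 \<le> r" "r \<le> d" for n r
  proof (induction n)
    case (Suc n)
    have "S (real (Suc n) * d + r) = S d o\<^sub>L S (real n * d + r)"
      using S_add[of d "real n * d + r"] d that by (simp add: algebra_simps)
    then have "norm (S (real (Suc n) * d + r) y) \<le> norm (S d) * norm (S (real n * d + r) y)"
      by (simp add: norm_blinfun)
    also have "\<dots> \<le> m * (m ^ n * K)"
      using m Suc by (intro mult_mono) auto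
    finally show ?case by (simp add: mult.assoc)
  qed (use small[OF that] in simp)
  have "norm (S t y) \<le> K * exp (ln m / d * t)" if t: "0 \<le> t" for t
  proof -
    define n where "n = nat \<lfloor>t / d\<rfloor>"
    have "0 \<le> t / d" using t d by simp
    then have "real n = of_int \<lfloor>t / d\<rfloor>" by (simp add: n_def)
    then have n: "real n \<le> t / d" "t / d < real n + 1" by linarith+
    then have r: "0 \<le> t - real n * d" "t - real n * d \<le> d"
      using d by (auto simp: field_simps)
    have "norm (S t y) \<le> m ^ n * K"
      using step[OF r, of n] by simp
    also have "m ^ n = exp (real n * ln m)"
      using m by (simp add: exp_of_nat_mult)
    also have "\<dots> \<le> exp (t / d * ln m)"
      unfolding exp_le_cancel_iff using n m by (intro mult_right_mono) auto
    finally show ?thesis using norm_ge_zero[of y] by (simp add: K_def mult.commute mult_left_mono)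
  qed
  then show ?thesis by (rule that)
qed

lemma right_continuous_scale:
  assumes "right_continuous f" "0 \<le> c"
  shows "right_continuous (\<lambda>\<theta>. f (c * \<theta>))"
\<comment> \<open>The scale is 0 at time t = 0, where the function becomes constant.\<close>
proof (cases "c = 0")
  case False
  with assms(2) have c: "0 < c" by simp
  show ?thesis
    unfolding right_continuous_def
  proof (intro allI impI)
    fix x :: real assume x: "0 \<le> x"
    have "filterlim (\<lambda>\<theta>. c * \<theta>) (at_right (c * x)) (at_right x)"
      unfolding filterlim_at
    proof (intro conjI)
      show "\<forall>\<^sub>F \<theta> in at_right x. c * \<theta> \<in> {c * x<..} \<and> c * \<theta> \<noteq> c * x"
        using eventually_at_right_less[of x] by eventually_elim (use c in auto)
    qed (intro tendsto_intros)
    moreover have "(f \<longlongrightarrow> f (c * x)) (at_right (c * x))"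
      using assms x by (simp add: right_continuous_def)
    ultimately show "((\<lambda>\<theta>. f (c * \<theta>)) \<longlongrightarrow> f (c * x)) (at_right x)"
      by (rule filterlim_compose[rotated])
  qed
qed (simp add: right_continuous_def)

section \<open>Additivity and initial value of the solution operator\<close>

context
  fixes \<alpha> :: real and S :: "real \<Rightarrow> 'h::banach \<Rightarrow>\<^sub>L 'h"
  assumes \<alpha>: "0 < \<alpha>" "\<alpha> \<le> 1" and S: "C0_semigroup S"
begin

lemma wright_semigroup_bound:
  assumes "\<alpha> < 1" "0 \<le> c"
  obtains C where "\<And>\<theta>. 0 \<le> \<theta> \<Longrightarrow> norm (wright \<alpha> \<theta> *\<^sub>R S (c * \<theta>) y) \<le> C * exp (- 1 * \<theta>)"
proof -
  obtain K \<omega> where K: "\<And>t. 0 \<le> t \<Longrightarrow> norm (S t y) \<le> K * exp (\<omega> * t)"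
    using C0_semigroup_exp_bound[OF S, of y] by blast
  \<comment> \<open>The scaled orbit grows at rate \<omega> c; one unit more in the decay leaves the
    rate 1.\<close>
  obtain L where L: "\<And>\<theta>. 0 \<le> \<theta> \<Longrightarrow> \<bar>wright \<alpha> \<theta>\<bar> \<le> L * exp (- (\<omega> * c + 1) * \<theta>)"
    using wright_decay[OF \<alpha>(1) assms(1), of "\<omega> * c + 1"] by blast
  have "norm (wright \<alpha> \<theta> *\<^sub>R S (c * \<theta>) y) \<le> (L * K) * exp (- 1 * \<theta>)" if "0 \<le> \<theta>" for \<theta>
  proof -
    have "norm (wright \<alpha> \<theta> *\<^sub>R S (c * \<theta>) y) = \<bar>wright \<alpha> \<theta>\<bar> * norm (S (c * \<theta>) y)" by simp
    also have "\<dots> \<le> (L * exp (- (\<omega> * c + 1) * \<theta>)) * (K * exp (\<omega> * (c * \<theta>)))"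
      using L[OF that] K[of "c * \<theta>"] that assms(2)
      by (intro mult_mono order_trans[OF abs_ge_zero L[OF that]]) auto
    also have "\<dots> = (L * K) * exp (- (\<omega> * c + 1) * \<theta> + \<omega> * (c * \<theta>))"
      by (simp only: exp_add mult_ac)
    also have "- (\<omega> * c + 1) * \<theta> + \<omega> * (c * \<theta>) = - 1 * \<theta>" by (simp add: algebra_simps)
    finally show ?thesis .
  qed
  then show ?thesis by (rule that)
qed

lemma right_continuous_wright_semigroup:
  assumes "\<alpha> < 1" "0 \<le> c"
  shows "right_continuous (\<lambda>\<theta>. wright \<alpha> \<theta> *\<^sub>R S (c * \<theta>) y)"
proof -
  have "(wright \<alpha> \<longlongrightarrow> wright \<alpha> x) (at_right x)" for x
    using isCont_wright[OF \<alpha>(1) assms(1), of x] by (simp add: isCont_def filterlim_at_split)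
  then show ?thesis
    using right_continuous_scale[OF C0_semigroup_right_continuous[OF S, of y] assms(2)]
    unfolding right_continuous_def by (auto intro!: tendsto_scaleR)
qed

lemma S_op_add: "S_op \<alpha> S t (y + z) = S_op \<alpha> S t y + S_op \<alpha> S t z"
proof (cases "\<alpha> = 1")
  case True
  then show ?thesis by (simp add: S_op_def blinfun.add_right)
next
  case False
  with \<alpha> have \<alpha>1: "\<alpha> < 1" by simp
  let ?f = "\<lambda>y \<theta>. wright \<alpha> \<theta> *\<^sub>R S (t powr \<alpha> * \<theta>) y"
  obtain C where C: "\<And>\<theta>. 0 \<le> \<theta> \<Longrightarrow> norm (?f y \<theta>) \<le> C * exp (- 1 * \<theta>)"
    using wright_semigroup_bound[OF \<alpha>1, of "t powr \<alpha>" y] by auto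
  obtain C' where C': "\<And>\<theta>. 0 \<le> \<theta> \<Longrightarrow> norm (?f z \<theta>) \<le> C' * exp (- 1 * \<theta>)"
    using wright_semigroup_bound[OF \<alpha>1, of "t powr \<alpha>" z] by auto
  have rc: "right_continuous (?f y)" "right_continuous (?f z)"
    by (intro right_continuous_wright_semigroup \<alpha>1 powr_ge_zero)+
  have "Bochner_int (lebesgue_on {0..}) (\<lambda>\<theta>. ?f y \<theta> + ?f z \<theta>)
      = Bochner_int (lebesgue_on {0..}) (?f y) + Bochner_int (lebesgue_on {0..}) (?f z)"
    by (rule Bochner_int_add[OF rc(1) C zero_less_one rc(2) C'])
  then show ?thesis
    using False by (simp add: S_op_def blinfun.add_right scaleR_add_right)
qed

text \<open>At time 0 the semigroup is evaluated at 0 for every \<theta>, so the Wright function, of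
  total integral 1, is integrated against the constant y.\<close>

lemma S_op_0: "S_op \<alpha> S 0 y = y"
proof (cases "\<alpha> = 1")
  case True
  then show ?thesis using S by (simp add: S_op_def C0_semigroup_def)
next
  case False
  with \<alpha> have \<alpha>1: "\<alpha> < 1" by simp
  obtain C where C: "\<And>\<theta>. 0 \<le> \<theta> \<Longrightarrow> \<bar>wright \<alpha> \<theta>\<bar> \<le> C * exp (- 1 * \<theta>)"
    using wright_decay[OF \<alpha>(1) \<alpha>1, of 1] by blast
  have "right_continuous (wright \<alpha>)"
    using isCont_wright[OF \<alpha>(1) \<alpha>1] by (simp add: right_continuous_def isCont_def filterlim_at_split)
  then have "Bochner_int (lebesgue_on {0..}) (\<lambda>\<theta>. wright \<alpha> \<theta> *\<^sub>R y) = 1 *\<^sub>R y"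
    using Bochner_int_scaleR_left[of "wright \<alpha>" C 1 y] C integral_wright[OF \<alpha>(1) \<alpha>1] by simp
  then show ?thesis
    using False S by (simp add: S_op_def C0_semigroup_def)
qed

end

section \<open>The recursion of the post-impulse states\<close>

lemma conv_refl: "conv \<alpha> S B u \<tau> \<tau> = 0"
  unfolding conv_def by (rule Bochner_int_null_measure) (simp add: emeasure_restrict_space)

lemma desc_prod_empty: "k < i \<Longrightarrow> desc_prod F k i y = y"
  by (simp add: desc_prod_def)

lemma desc_prod_Suc: "i \<le> Suc k \<Longrightarrow> desc_prod F (Suc k) i y = F (Suc k) (desc_prod F k i y)"
  by (simp add: desc_prod_def)

text \<open>A term \<open>g i\<close> enters after \<open>F i\<close> has acted, so its product
  begins at i + 1; the jump \<open>e (i - 1)\<close> is first propagated by \<open>F i\<close>. The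
  recursion starts at 1 because \<open>z 0\<close> would contain a spurious
  \<open>e 0\<close>.\<close>

lemma affine_recursion_desc_prod:
  fixes F :: "nat \<Rightarrow> 'h::real_normed_vector \<Rightarrow> 'h" and g e :: "nat \<Rightarrow> 'h" and y :: 'h
  assumes add: "\<And>j. Modules.additive (F j)"
  defines "z \<equiv> \<lambda>k. desc_prod F k 1 y + (\<Sum>i=1..k. desc_prod F k (i + 1) (g i))
    + (\<Sum>i=2..k. desc_prod F k i (e (i - 1))) + e k"
  shows "z 1 = F 1 y + g 1 + e 1"
    and "1 \<le> k \<Longrightarrow> z (Suc k) = F (Suc k) (z k) + g (Suc k) + e (Suc k)"
proof -
  show "z 1 = F 1 y + g 1 + e 1"
    using desc_prod_Suc[of 1 0 F y] by (simp add: z_def desc_prod_empty)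
  assume k: "1 \<le> k"
  interpret Modules.additive "F (Suc k)" by (rule add)
  have "(\<Sum>i=1..Suc k. desc_prod F (Suc k) (i + 1) (g i))
      = F (Suc k) (\<Sum>i=1..k. desc_prod F k (i + 1) (g i)) + g (Suc k)"
    by (simp add: sum desc_prod_Suc desc_prod_empty)
  moreover have "(\<Sum>i=2..Suc k. desc_prod F (Suc k) i (e (i - 1)))
      = F (Suc k) (\<Sum>i=2..k. desc_prod F k i (e (i - 1))) + F (Suc k) (e k)"
    using k by (simp add: sum desc_prod_Suc desc_prod_empty)
  ultimately show "z (Suc k) = F (Suc k) (z k) + g (Suc k) + e (Suc k)"
    unfolding z_def by (simp add: desc_prod_Suc add)
qed

text \<open>An equivalence, because the formula also produces solutions: its closed form reproduces
  the post-impulse states. Existence of the convolution integrals stands on both sides.\<close>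

theorem lemma2:
  fixes \<alpha> b :: real
    and n :: nat
    and T :: "nat \<Rightarrow> real"
    and dom_A :: "'h::{real_inner, banach} set"
    and A :: "'h \<Rightarrow> 'h"
    and S :: "real \<Rightarrow> 'h \<Rightarrow>\<^sub>L 'h"
    and B :: "'u::{real_inner, banach} \<Rightarrow>\<^sub>L 'h"
    and D :: "nat \<Rightarrow> 'h \<Rightarrow>\<^sub>L 'h"
    and E :: "nat \<Rightarrow> 'u \<Rightarrow>\<^sub>L 'h"
    and x0 :: 'h
    and u :: "real \<Rightarrow> 'u"
    and v :: "nat \<Rightarrow> 'u"
    and x :: "real \<Rightarrow> 'h"
  assumes "0 < \<alpha>" and "\<alpha> \<le> 1"
    and "n \<ge> 1"
    and "T 0 = 0" and "\<forall>k\<le>n. T k < T (Suc k)" and "T (Suc n) = b"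
    and "generates_C0_semigroup dom_A A S"
    and "L2_on {0..b} u"
  shows "let
      F = (\<lambda>j y. (id_blinfun + D j) (S_op \<alpha> S (T j - T (j - 1)) y));
      xplus = (\<lambda>k. desc_prod F k 1 x0
        + (\<Sum>i=1..k. desc_prod F k (i + 1)
            ((id_blinfun + D i) (conv \<alpha> S B u (T (i - 1)) (T i))))
        + (\<Sum>i=2..k. desc_prod F k i (E (i - 1) (v (i - 1))))
        + E k (v k))
    in
      (impulsive_mild_solution \<alpha> S B D E n T x0 u v x \<longleftrightarrow>
        x 0 = x0 \<and>
        (\<forall>t\<in>{0..T 1}. conv_exists \<alpha> S B u 0 t \<and>
          x t = S_op \<alpha> S t (x 0) + conv \<alpha> S B u 0 t) \<and>
        (\<forall>k\<in>{1..n}. \<forall>t\<in>{T k<..T (Suc k)}. conv_exists \<alpha> S B u (T k) t \<and>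
          x t = S_op \<alpha> S (t - T k) (xplus k) + conv \<alpha> S B u (T k) t)) \<and>
      (impulsive_mild_solution \<alpha> S B D E n T x0 u v x \<longrightarrow>
        (\<forall>k\<in>{1..n}. post_impulse D E v T x k = xplus k))"
proof -
  define F where "F = (\<lambda>j y. (id_blinfun + D j) (S_op \<alpha> S (T j - T (j - 1)) y))"
  define g where "g i = (id_blinfun + D i) (conv \<alpha> S B u (T (i - 1)) (T i))" for i
  define e where "e i = E i (v i)" for i
  define xplus where "xplus k = desc_prod F k 1 x0 + (\<Sum>i=1..k. desc_prod F k (i + 1) (g i))
    + (\<Sum>i=2..k. desc_prod F k i (e (i - 1))) + e k" for k
  have S: "C0_semigroup S"
    using assms(7) by (simp add: generates_C0_semigroup_def)
  have add: "Modules.additive (F j)" for j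
    by unfold_locales (simp add: F_def S_op_add[OF assms(1,2) S] blinfun.add_right)
  have rec: "xplus 1 = F 1 x0 + g 1 + e 1"
    "1 \<le> k \<Longrightarrow> xplus (Suc k) = F (Suc k) (xplus k) + g (Suc k) + e (Suc k)" for k
    unfolding xplus_def by (fact affine_recursion_desc_prod[OF add])+
  have T01: "0 \<le> T 1"
    using assms(4,5) by fastforce
  \<comment> \<open>Distributing I + D_k over the two summands of x (t_k) yields the linear term
    \<open>F k\<close> and the inhomogeneity \<open>g k\<close> of the recursion.\<close>
  have impulse_1: "post_impulse D E v T x 1 = xplus 1"
    if "x (T 1) = S_op \<alpha> S (T 1) x0 + conv \<alpha> S B u 0 (T 1)"
    unfolding rec(1) post_impulse_def that
    by (simp add: F_def g_def e_def assms(4) blinfun.add_right)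
  have impulse_Suc: "post_impulse D E v T x (Suc k) = xplus (Suc k)"
    if "1 \<le> k" "x (T (Suc k)) = S_op \<alpha> S (T (Suc k) - T k) (xplus k) + conv \<alpha> S B u (T k) (T (Suc k))" for k
    unfolding rec(2)[OF that(1)] post_impulse_def that(2)
    by (simp add: F_def g_def e_def blinfun.add_right)
  \<comment> \<open>The intervals are closed on the right, so the state just before an impulse is
    still governed by the preceding post-impulse state.\<close>
  have T_mem: "T (Suc k) \<in> {T k<..T (Suc k)}" if "k \<le> n" for k
    using assms(5) that by simp
  let ?sol = "impulsive_mild_solution \<alpha> S B D E n T x0 u v x"
  let ?first = "\<forall>t\<in>{0..T 1}. conv_exists \<alpha> S B u 0 t \<and> x t = S_op \<alpha> S t (x 0) + conv \<alpha> S B u 0 t"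
  let ?later = "\<forall>k\<in>{1..n}. \<forall>t\<in>{T k<..T (Suc k)}. conv_exists \<alpha> S B u (T k) t \<and>
    x t = S_op \<alpha> S (t - T k) (xplus k) + conv \<alpha> S B u (T k) t"
  have impulse: "\<forall>k\<in>{1..n}. post_impulse D E v T x k = xplus k" if sol: ?sol
  proof -
    have "1 \<le> k \<Longrightarrow> k \<le> n \<Longrightarrow> post_impulse D E v T x k = xplus k" for k
    proof (induction k)
      case (Suc k)
      show ?case
      proof (cases "k = 0")
        case True
        have "x (T 1) = S_op \<alpha> S (T 1) x0 + conv \<alpha> S B u 0 (T 1)"
          using sol T01 by (simp add: impulsive_mild_solution_def mild_solution_on_def)
        then show ?thesis using impulse_1 True by simp
      next
        case False
        then have IH: "post_impulse D E v T x k = xplus k" using Suc by simp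
        have "mild_solution_on \<alpha> S B u (T k) (xplus k) {T k<..T (Suc k)} x"
          using sol False Suc.prems unfolding IH[symmetric] by (simp add: impulsive_mild_solution_def)
        then show ?thesis
          using impulse_Suc[of k] T_mem[of k] False Suc.prems by (simp add: mild_solution_on_def)
      qed
    qed simp
    then show ?thesis by simp
  qed
  have "?sol \<longleftrightarrow> x 0 = x0 \<and> ?first \<and> ?later"
  proof
    assume sol: ?sol
    then have first: "mild_solution_on \<alpha> S B u 0 x0 {0..T 1} x"
      and later: "\<And>k. k \<in> {1..n} \<Longrightarrow>
        mild_solution_on \<alpha> S B u (T k) (post_impulse D E v T x k) {T k<..T (Suc k)} x"
      by (auto simp: impulsive_mild_solution_def)
    \<comment> \<open>The initial condition is hidden in the formula at t = 0, where
      \<open>S_op\<close> is the identity and the convolution runs over a null set.\<close>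
    have "x 0 = S_op \<alpha> S (0 - 0) x0 + conv \<alpha> S B u 0 0"
      using first T01 unfolding mild_solution_on_def by (metis atLeastAtMost_iff order_refl)
    then have "x 0 = x0"
      by (simp add: S_op_0[OF assms(1,2) S] conv_refl)
    then show "x 0 = x0 \<and> ?first \<and> ?later"
      using first later impulse[OF sol] by (simp add: mild_solution_on_def)
  next
    assume R: "x 0 = x0 \<and> ?first \<and> ?later"
    \<comment> \<open>In this direction one recursion step suffices in place of an induction, as the
      formula on the preceding interval already contains \<open>xplus\<close>.\<close>
    have "post_impulse D E v T x k = xplus k" if k: "k \<in> {1..n}" for k
    proof (cases "k = 1")
      case True
      then show ?thesis using impulse_1 R T01 by simp
    next
      case False
      then obtain j where j: "k = Suc j" "j \<in> {1..n}" using k by (cases k) auto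
      then show ?thesis using impulse_Suc[of j] T_mem[of j] R by simp
    qed
    then show ?sol
      using R by (simp add: impulsive_mild_solution_def mild_solution_on_def)
  qed
  with impulse show ?thesis
    unfolding Let_def xplus_def F_def g_def e_def by blast
qed

end
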